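(* Let $N$ be an odd positive integer and let $N^*$ be the greatest square dividing $N$. Then \[\mathcal{N}_2(N)=|\mathcal{P}_2|N^2+\frac13+2\sqrt{N^*}-\frac{4}{\pi}\sum_{\substack{d\mid N\\ d\equiv 3\ (\mathrm{mod}\ 4)}}\sqrt{d}\,L(1,\chi_{-d}),\] where $L(1,\chi_{-d})$ is the Dirichlet $L$-function at $s=1$ of the Kronecker symbol $\chi_{-d}=\left(\frac{-d}{\cdot}\right)$.
   Context: $\mathcal{P}_2=\{(x,y)\in\mathbb{R}^2 : |y|\le 1-x^2\}$, whose area is $|\mathcal{P}_2|=8/3$, and for $R>0$, $\mathcal{N}_2(R)=\#\{\vec{n}\in\mathbb{Z}^2 : R^{-1}\vec{n}\in\mathcal{P}_2\}$. *)

theory Defs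
  imports
    "HOL-Analysis.Analysis"
    "HOL-Computational_Algebra.Computational_Algebra"
    "HOL-Number_Theory.Number_Theory"
begin

definition parabolic_region :: "(real \<times> real) set" where
  "parabolic_region = {(x, y). \<bar>y\<bar> \<le> 1 - x\<^sup>2}"

definition lattice_count :: "real \<Rightarrow> nat" where
  "lattice_count R =
     card {n :: int \<times> int.
       inverse R *\<^sub>R (real_of_int (fst n), real_of_int (snd n)) \<in> parabolic_region}"

definition greatest_square_divisor :: "nat \<Rightarrow> nat" where
  "greatest_square_divisor N = Max {m. m dvd N \<and> is_square m}"

text \<open>
  The Kronecker symbol extends the Legendre symbol to an arbitrary integer lower argument,
  multiplicatively over the factorization of that argument into its sign and its primes.
\<close>

definition kronecker_prime :: "int \<Rightarrow> int \<Rightarrow> int" where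
  "kronecker_prime a p =
     (if p = 2 then
        (if even a then 0 else if [a = 1] (mod 8) \<or> [a = -1] (mod 8) then 1 else -1)
      else Legendre a p)"

definition kronecker :: "int \<Rightarrow> int \<Rightarrow> int" where
  "kronecker a n =
     (if n = 0 then (if \<bar>a\<bar> = 1 then 1 else 0)
      else (if n < 0 \<and> a < 0 then -1 else 1) *
           (\<Prod>p \<in> prime_factors n. kronecker_prime a p ^ multiplicity p n))"

text \<open>
  The sum is taken in the natural order of the terms, so that for a non-principal character
  it converges (conditionally, where \<open>s \<le> 1\<close>) to the value of the \<open>L\<close>-function for all real
  \<open>s > 0\<close>, in particular at \<open>s = 1\<close>.
\<close>

definition Dirichlet_L :: "real \<Rightarrow> (int \<Rightarrow> int) \<Rightarrow> real" where
  "Dirichlet_L s chi = (\<Sum>n. real_of_int (chi (int (Suc n))) / real (Suc n) powr s)"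

end

theory Submission
  imports Defs "HOL-Real_Asymp.Real_Asymp"
begin

text \<open>
  Counting column by column gives
  \<open>8/3 N\<^sup>2 + 1/3 + 2 b - 4 S\<close>, where \<open>b\<^sup>2\<close> is the greatest square dividing \<open>N\<close> and
  \<open>S\<close> is the sum over \<open>m\<close> modulo \<open>N\<close> of \<open>1/2 - {m\<^sup>2/N}\<close>, taken to be \<open>0\<close> where \<open>N\<close> divides \<open>m\<^sup>2\<close>.
  Expanding the sawtooth into its sine series turns \<open>\<pi> S\<close> into the sum over \<open>k\<close> of \<open>Im G(k, N) / k\<close>
  with the quadratic Gauss sums \<open>G(k, N)\<close>. Grouping the \<open>k\<close> by \<open>gcd(k, N) = N/d\<close> leaves, for each divisor
  \<open>d\<close> of \<open>N\<close>, the sum over \<open>k\<close> coprime to \<open>d\<close> of \<open>Im G(k, d) / k\<close>. For such \<open>k\<close> the Gauss sum is real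
  if \<open>d\<close> is \<open>1\<close> modulo \<open>4\<close>, and it is \<open>i \<surd>d \<chi>(k)\<close> with \<open>\<chi>\<close> the Kronecker symbol of \<open>-d\<close> if \<open>d\<close> is \<open>3\<close> modulo \<open>4\<close>.

  The sign of \<open>G(1, n)\<close> comes from Gauss's evaluation of alternating sums of \<open>q\<close>-binomial
  coefficients at a root of unity, which writes it as a product of sines for every odd \<open>n\<close>. The
  dependence on \<open>k\<close> then follows from the multiplicativity of \<open>k \<mapsto> G(k, d) / G(1, d)\<close> and, at an
  odd prime \<open>q\<close>, from \<open>G(q, d) G(d, q) = G(1, q d)\<close>.
\<close>

subsection \<open>Quadratic Gauss sums\<close>

definition unity_root :: "nat \<Rightarrow> int \<Rightarrow> complex" where
  "unity_root n k = cis (2 * pi * real_of_int k / real n)"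

lemma unity_root_0 [simp]: "unity_root n 0 = 1"
  by (simp add: unity_root_def)

lemma unity_root_nonzero [simp]: "unity_root n k \<noteq> 0"
  by (simp add: unity_root_def)

lemma unity_root_add: "unity_root n (a + b) = unity_root n a * unity_root n b"
  by (simp add: unity_root_def cis_mult ring_distribs add_divide_distrib)

lemma unity_root_minus: "unity_root n (- a) = inverse (unity_root n a)"
  by (simp add: unity_root_def cis_inverse)

lemma unity_root_diff: "unity_root n (a - b) = unity_root n a / unity_root n b"
  using unity_root_add[of n a "-b"] by (simp add: unity_root_minus field_simps)

lemma cnj_unity_root: "cnj (unity_root n a) = unity_root n (- a)"
  by (simp add: unity_root_def cis_cnj)

lemma unity_root_power: "unity_root n a ^ k = unity_root n (int k * a)"
  by (simp add: unity_root_def Complex.DeMoivre mult_ac)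

lemma unity_root_mult_cancel: "m > 0 \<Longrightarrow> unity_root (m * n) (int m * a) = unity_root n a"
  by (simp add: unity_root_def mult.left_commute[of _ "real m"])

lemma unity_root_eq_1_iff:
  assumes "n > 0"
  shows "unity_root n k = 1 \<longleftrightarrow> int n dvd k"
proof
  assume "int n dvd k"
  then obtain j where "k = int n * j" by (elim dvdE)
  then have "2 * pi * of_int k / of_nat n = 2 * pi * of_int j"
    using assms by simp
  then have "unity_root n k = cis (2 * pi * of_int j)"
    by (simp only: unity_root_def)
  also have "\<dots> = 1"
    by (rule cis_multiple_2pi) simp
  finally show "unity_root n k = 1" .
next
  assume "unity_root n k = 1"
  then have "cos (2 * pi * real_of_int k / real n) = 1"
    by (metis unity_root_def cis.simps(1) one_complex.simps(1))
  then obtain j :: int where "2 * pi * real_of_int k / real n = of_int j * 2 * pi"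
    using cos_one_2pi_int by blast
  then have "real_of_int k = real_of_int (j * int n)"
    using assms by (simp add: field_simps)
  then have "k = j * int n"
    by linarith
  then show "int n dvd k" by simp
qed

lemma unity_root_cong:
  assumes "[a = b] (mod int n)"
  shows "unity_root n a = unity_root n b"
proof (cases "n = 0")
  case False
  have "unity_root n (a - b) = 1"
    using assms False by (simp add: unity_root_eq_1_iff cong_iff_dvd_diff)
  then show ?thesis
    by (simp add: unity_root_diff)
qed (use assms in \<open>simp add: cong_def\<close>)

text \<open>The change of variables behind most later substitutions: \<open>n\<close> pairwise
  incongruent values \<open>h a\<close> meet every class exactly once. The index set is arbitrary,
  so that shifts, dilations, pairs of residues and ranges of naturals all fit.\<close>

lemma sum_complete_residues:
  fixes f :: "int \<Rightarrow> 'b :: comm_monoid_add"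
  assumes "n > 0" "finite A" "card A = n"
    and inj: "\<And>a b. a \<in> A \<Longrightarrow> b \<in> A \<Longrightarrow> [h a = h b] (mod int n) \<Longrightarrow> a = b"
    and per: "\<And>x y. [x = y] (mod int n) \<Longrightarrow> f x = f y"
  shows "(\<Sum>a\<in>A. f (h a)) = (\<Sum>x\<in>{0..<int n}. f x)"
proof -
  have inj': "inj_on (\<lambda>a. h a mod int n) A"
    using inj by (auto simp: inj_on_def cong_def)
  have "(\<lambda>a. h a mod int n) ` A = {0..<int n}"
  proof (rule card_subset_eq)
    show "(\<lambda>a. h a mod int n) ` A \<subseteq> {0..<int n}"
      using \<open>n > 0\<close> by auto
    show "card ((\<lambda>a. h a mod int n) ` A) = card {0..<int n}"
      using inj' assms(3) by (simp add: card_image)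
  qed auto
  then have "(\<Sum>x\<in>{0..<int n}. f x) = (\<Sum>a\<in>A. f (h a mod int n))"
    using inj' by (metis (no_types, lifting) sum.reindex_cong)
  also have "\<dots> = (\<Sum>a\<in>A. f (h a))"
    by (intro sum.cong per) (auto simp: cong_def)
  finally show ?thesis ..
qed

lemma cong_int_interval_imp_eq:
  "[a = b] (mod int n) \<Longrightarrow> a \<in> {0..<int n} \<Longrightarrow> b \<in> {0..<int n} \<Longrightarrow> a = b"
  by (simp add: cong_def)

text \<open>If \<open>n\<close> does not divide \<open>k\<close>, shifting \<open>x\<close> by 1
  permutes the residues but multiplies the sum by \<open>unity_root n k\<close>, which is not
  1.\<close>

lemma sum_unity_root:
  assumes "n > 0"
  shows "(\<Sum>x\<in>{0..<int n}. unity_root n (k * x)) = (if int n dvd k then of_nat n else 0)"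
proof (cases "int n dvd k")
  case True
  then have "unity_root n (k * x) = 1" for x
    using assms by (simp add: unity_root_eq_1_iff)
  then show ?thesis using True by simp
next
  case False
  let ?S = "\<Sum>x\<in>{0..<int n}. unity_root n (k * x)"
  have "(\<Sum>x\<in>{0..<int n}. unity_root n (k * (x + 1))) = ?S"
  proof (rule sum_complete_residues)
    fix a b assume "a \<in> {0..<int n}" "b \<in> {0..<int n}" "[a + 1 = b + 1] (mod int n)"
    then show "a = b"
      using cong_add_rcancel cong_int_interval_imp_eq by blast
  qed (use assms in \<open>auto intro: unity_root_cong cong_scalar_left\<close>)
  also have "(\<Sum>x\<in>{0..<int n}. unity_root n (k * (x + 1))) = unity_root n k * ?S"
    by (simp add: ring_distribs unity_root_add sum_distrib_left mult_ac)
  finally have "(unity_root n k - 1) * ?S = 0"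
    by (simp add: ring_distribs)
  then show ?thesis
    using False assms by (simp add: unity_root_eq_1_iff)
qed

section \<open>Behaviour of Gauss sums under changes of the multiplier and of the modulus\<close>

definition gauss_sum :: "int \<Rightarrow> nat \<Rightarrow> complex" where
  "gauss_sum k n = (\<Sum>x\<in>{0..<int n}. unity_root n (k * x\<^sup>2))"

lemma gauss_sum_1 [simp]: "gauss_sum k (Suc 0) = 1"
proof -
  have "{0..<1} = {0::int}" by auto
  then show ?thesis by (simp add: gauss_sum_def)
qed

lemma gauss_sum_cong:
  assumes "[k = l] (mod int n)"
  shows "gauss_sum k n = gauss_sum l n"
  unfolding gauss_sum_def using assms
  by (intro sum.cong refl unity_root_cong cong_scalar_right)

lemma gauss_sum_mult_square:
  assumes "n > 0" "coprime t (int n)"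
  shows "gauss_sum (k * t\<^sup>2) n = gauss_sum k n"
proof -
  have "(\<Sum>x\<in>{0..<int n}. unity_root n (k * (t * x)\<^sup>2)) = gauss_sum k n"
    unfolding gauss_sum_def
  proof (rule sum_complete_residues)
    fix a b assume "a \<in> {0..<int n}" "b \<in> {0..<int n}" "[t * a = t * b] (mod int n)"
    then show "a = b"
      using assms(2) by (metis cong_int_interval_imp_eq cong_mult_lcancel)
  qed (use assms in \<open>auto intro!: unity_root_cong cong_scalar_left cong_pow\<close>)
  then show ?thesis
    by (simp add: gauss_sum_def power_mult_distrib mult_ac)
qed

text \<open>By the Chinese remainder theorem a n + b m represents every class modulo m n once. The
  cross term of its square is a multiple of m n, so the character splits into one modulo
  \<open>m\<close> and one modulo \<open>n\<close>.\<close>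

lemma gauss_sum_mult_modulus:
  assumes "m > 0" "n > 0" "coprime m n"
  shows "gauss_sum k (m * n) = gauss_sum (k * int m) n * gauss_sum (k * int n) m"
proof -
  let ?A = "{0..<int m} \<times> {0..<int n}"
  have "gauss_sum k (m * n) =
      (\<Sum>z\<in>?A. unity_root (m * n) (k * (fst z * int n + snd z * int m)\<^sup>2))"
    unfolding gauss_sum_def
  proof (rule sum_complete_residues[symmetric])
    fix z w assume zw: "z \<in> ?A" "w \<in> ?A"
      and c: "[fst z * int n + snd z * int m = fst w * int n + snd w * int m] (mod int (m * n))"
    have "[fst z * int n + snd z * int m = fst w * int n + snd w * int m] (mod int m)"
      using c by (rule cong_dvd_modulus) simp
    then have "[fst z * int n = fst w * int n] (mod int m)"
      by (simp add: cong_def)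
    then have "[fst z = fst w] (mod int m)"
      using assms by (subst (asm) cong_mult_rcancel) (auto simp: coprime_commute)
    moreover have "[fst z * int n + snd z * int m = fst w * int n + snd w * int m] (mod int n)"
      using c by (rule cong_dvd_modulus) simp
    then have "[snd z * int m = snd w * int m] (mod int n)"
      by (simp add: cong_def)
    then have "[snd z = snd w] (mod int n)"
      using assms by (subst (asm) cong_mult_rcancel) auto
    ultimately show "z = w"
      using zw by (auto simp: prod_eq_iff intro: cong_int_interval_imp_eq)
  qed (use assms in \<open>auto intro!: unity_root_cong cong_scalar_left cong_pow\<close>)
  also have "\<dots> = (\<Sum>z\<in>?A. unity_root m (k * int n * (fst z)\<^sup>2) * unity_root n (k * int m * (snd z)\<^sup>2))"
  proof (rule sum.cong[OF refl])
    fix z :: "int \<times> int"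
    have "unity_root (m * n) (k * (fst z * int n + snd z * int m)\<^sup>2) =
        unity_root (m * n) (int n * (k * int n * (fst z)\<^sup>2) + int m * (k * int m * (snd z)\<^sup>2))"
      by (rule unity_root_cong, rule cong_sym, subst cong_iff_dvd_diff)
         (rule dvdI[of _ _ "- (2 * k * fst z * snd z)"], simp add: power2_eq_square algebra_simps)
    also have "\<dots> = unity_root m (k * int n * (fst z)\<^sup>2) * unity_root n (k * int m * (snd z)\<^sup>2)"
      using assms unity_root_mult_cancel[of m n] unity_root_mult_cancel[of n m]
      by (simp add: unity_root_add mult.commute[of n m])
    finally show "unity_root (m * n) (k * (fst z * int n + snd z * int m)\<^sup>2) = \<dots>" .
  qed
  also have "\<dots> = gauss_sum (k * int m) n * gauss_sum (k * int n) m"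
    unfolding gauss_sum_def
    by (simp add: sum_product sum.cartesian_product case_prod_unfold mult.commute)
  finally show ?thesis .
qed

lemma sum_residues_blocks:
  fixes f :: "int \<Rightarrow> 'b :: comm_monoid_add"
  assumes "m > 0" "g > 0" and per: "\<And>x y. [x = y] (mod int (m * g)) \<Longrightarrow> f x = f y"
  shows "(\<Sum>x\<in>{0..<int (m * g)}. f x) = (\<Sum>a\<in>{0..<int m}. \<Sum>b\<in>{0..<int g}. f (a + int m * b))"
proof -
  let ?A = "{0..<int m} \<times> {0..<int g}"
  have "(\<Sum>z\<in>?A. f (fst z + int m * snd z)) = (\<Sum>x\<in>{0..<int (m * g)}. f x)"
  proof (rule sum_complete_residues)
    fix z w assume zw: "z \<in> ?A" "w \<in> ?A"
      and c: "[fst z + int m * snd z = fst w + int m * snd w] (mod int (m * g))"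
    have "[fst z + int m * snd z = fst w + int m * snd w] (mod int m)"
      using c by (rule cong_dvd_modulus) simp
    then have "[fst z = fst w] (mod int m)"
      by (simp add: cong_def)
    then have fst: "fst z = fst w"
      using zw by (auto intro: cong_int_interval_imp_eq)
    with c have "int m * int g dvd int m * (snd z - snd w)"
      by (simp add: cong_iff_dvd_diff algebra_simps)
    then have "[snd z = snd w] (mod int g)"
      using assms by (simp add: cong_iff_dvd_diff)
    then have "snd z = snd w"
      using zw by (auto intro: cong_int_interval_imp_eq)
    with fst show "z = w"
      by (simp add: prod_eq_iff)
  qed (use assms in auto)
  then show ?thesis
    by (simp add: sum.cartesian_product case_prod_unfold)
qed

text \<open>The character depends only on x modulo \<open>n\<close>, and each class modulo
  \<open>n\<close> occurs \<open>g\<close> times. This is how a common factor of multiplier and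
  modulus is removed.\<close>

lemma gauss_sum_scale:
  assumes "n > 0" "g > 0"
  shows "gauss_sum (int g * k) (n * g) = of_nat g * gauss_sum k n"
proof -
  have "gauss_sum (int g * k) (n * g) =
      (\<Sum>a\<in>{0..<int n}. \<Sum>b\<in>{0..<int g}. unity_root (n * g) (int g * k * (a + int n * b)\<^sup>2))"
    unfolding gauss_sum_def
    by (rule sum_residues_blocks) (use assms in \<open>auto intro!: unity_root_cong cong_scalar_left cong_pow\<close>)
  also have "\<dots> = (\<Sum>a\<in>{0..<int n}. \<Sum>b\<in>{0..<int g}. unity_root n (k * a\<^sup>2))"
  proof (intro sum.cong refl)
    fix a b
    have "unity_root (n * g) (int g * k * (a + int n * b)\<^sup>2) = unity_root n (k * (a + int n * b)\<^sup>2)"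
      using unity_root_mult_cancel[of g n "k * (a + int n * b)\<^sup>2"] assms by (simp add: mult_ac)
    also have "\<dots> = unity_root n (k * a\<^sup>2)"
      by (intro unity_root_cong cong_scalar_left cong_pow) (simp add: cong_def)
    finally show "unity_root (n * g) (int g * k * (a + int n * b)\<^sup>2) = \<dots>" .
  qed
  also have "\<dots> = of_nat g * gauss_sum k n"
    by (simp add: gauss_sum_def sum_distrib_left)
  finally show ?thesis .
qed

text \<open>Write x = a + p m b. Modulo p^2 m its square is a^2 + 2 a b p m, so the sum over b is a
  full character sum modulo \<open>p\<close> that kills every a not divisible by \<open>p\<close>.
  The remaining a = p c give \<open>p\<close> times the Gauss sum modulo \<open>m\<close>.\<close>

lemma gauss_sum_prime_square:
  assumes "m > 0" "prime p" "odd p" "coprime k (int p)"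
  shows "gauss_sum k (p\<^sup>2 * m) = of_nat p * gauss_sum k m"
proof -
  have p: "p > 0" using assms(2) by (simp add: prime_gt_0_nat)
  have "gauss_sum k (p * m * p) =
      (\<Sum>a\<in>{0..<int (p * m)}. \<Sum>b\<in>{0..<int p}. unity_root (p * m * p) (k * (a + int (p * m) * b)\<^sup>2))"
    unfolding gauss_sum_def
    by (rule sum_residues_blocks) (use assms p in \<open>auto intro!: unity_root_cong cong_scalar_left cong_pow\<close>)
  also have "\<dots> = (\<Sum>a\<in>{0..<int (p * m)}. unity_root (p * m * p) (k * a\<^sup>2) *
      (\<Sum>b\<in>{0..<int p}. unity_root p (2 * k * a * b)))"
    unfolding sum_distrib_left
  proof (intro sum.cong refl)
    fix a b
    have "unity_root (p * m * p) (k * (a + int (p * m) * b)\<^sup>2) =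
        unity_root (p * m * p) (k * a\<^sup>2 + int (p * m) * (2 * k * a * b))"
      by (rule unity_root_cong, subst cong_iff_dvd_diff)
         (rule dvdI[of _ _ "k * int m * b\<^sup>2"], simp add: power2_eq_square algebra_simps)
    also have "\<dots> = unity_root (p * m * p) (k * a\<^sup>2) * unity_root p (2 * k * a * b)"
      using unity_root_mult_cancel[of "p * m" p "2 * k * a * b"] assms p by (simp add: unity_root_add)
    finally show "unity_root (p * m * p) (k * (a + int (p * m) * b)\<^sup>2) = \<dots>" .
  qed
  also have "\<dots> = (\<Sum>a\<in>{0..<int (m * p)}. unity_root (p * m * p) (k * a\<^sup>2) *
      (if int p dvd a then of_nat p else 0))"
  proof -
    have "int p dvd 2 * k * a \<longleftrightarrow> int p dvd a" for a
    proof -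
      have "coprime (int p) (2 * k)"
        using assms by (simp add: coprime_commute)
      then show ?thesis
        by (rule coprime_dvd_mult_right_iff)
    qed
    then show ?thesis
      using p by (simp only: sum_unity_root mult.commute[of m p])
  qed
  also have "\<dots> = (\<Sum>c\<in>{0..<int m}. unity_root (p * m * p) (k * (int p * c)\<^sup>2) * of_nat p)"
  proof -
    have "(\<Sum>a\<in>{0..<int (m * p)}. unity_root (p * m * p) (k * a\<^sup>2) *
        (if int p dvd a then of_nat p else 0)) =
        (\<Sum>a\<in>(\<lambda>c. int p * c) ` {0..<int m}. unity_root (p * m * p) (k * a\<^sup>2) * of_nat p)"
    proof (rule sum.mono_neutral_cong_right)
      have "a \<in> (\<lambda>c. int p * c) ` {0..<int m}"
        if "a \<in> {0..<int (m * p)}" "int p dvd a" for a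
        using that p by (auto simp: zero_le_mult_iff mult.commute elim!: dvdE intro!: imageI)
      then show "\<forall>a\<in>{0..<int (m * p)} - (\<lambda>c. int p * c) ` {0..<int m}.
          unity_root (p * m * p) (k * a\<^sup>2) * (if int p dvd a then of_nat p else 0) = 0"
        by auto
    qed (use p in \<open>auto simp: mult.commute\<close>)
    also have "\<dots> = (\<Sum>c\<in>{0..<int m}. unity_root (p * m * p) (k * (int p * c)\<^sup>2) * of_nat p)"
      using p by (subst sum.reindex) (auto simp: inj_on_def)
    finally show ?thesis .
  qed
  also have "\<dots> = of_nat p * gauss_sum k m"
  proof -
    have "unity_root (p * m * p) (k * (int p * c)\<^sup>2) = unity_root m (k * c\<^sup>2)" for c
      using unity_root_mult_cancel[of "p\<^sup>2" m "k * c\<^sup>2"] p by (simp add: power2_eq_square mult_ac)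
    then show ?thesis
      by (simp add: gauss_sum_def sum_distrib_left mult_ac)
  qed
  finally show ?thesis
    by (simp add: power2_eq_square mult_ac)
qed

subsection \<open>Gauss sums as products of sines\<close>

text \<open>Gaussian binomial coefficients, given by the q-Pascal rule instead of a quotient of
  products: no division by \<open>1 - q ^ i\<close> occurs, and the identities hold in every
  commutative ring.\<close>

fun qbinomial :: "'a::comm_ring_1 \<Rightarrow> nat \<Rightarrow> nat \<Rightarrow> 'a" where
  "qbinomial q m 0 = 1"
| "qbinomial q 0 (Suc j) = 0"
| "qbinomial q (Suc m) (Suc j) = qbinomial q m j + q ^ Suc j * qbinomial q m (Suc j)"

lemma qbinomial_eq_0: "j > m \<Longrightarrow> qbinomial q m j = 0"
  by (induction q m j rule: qbinomial.induct) auto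

text \<open>The q-analogue of (j + 1) C(m + 1, j + 1) = (m + 1) C(m, j), in place of the quotient
  formula.\<close>

lemma qbinomial_absorption:
  "(1 - q ^ Suc j) * qbinomial q (Suc m) (Suc j) = (1 - q ^ Suc m) * qbinomial q m j"
proof (induction m arbitrary: j)
  case 0
  then show ?case by (cases j) auto
next
  case (Suc m)
  show ?case
  proof (cases j)
    case 0
    define Y where "Y = qbinomial q (Suc m) (Suc 0)"
    have E: "qbinomial q (Suc (Suc m)) (Suc 0) = 1 + q * Y"
      by (simp add: Y_def)
    have Y: "(1 - q) * Y = 1 - q ^ Suc m"
      using Suc.IH[of 0] by (simp add: Y_def del: qbinomial.simps(3))
    have "(1 - q) * (1 + q * Y) = (1 - q) + q * ((1 - q) * Y)"
      by (simp add: algebra_simps)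
    also have "\<dots> = 1 - q ^ Suc (Suc m)"
      unfolding Y by (simp add: algebra_simps)
    finally show ?thesis
      using 0 E by (simp del: qbinomial.simps(3))
  next
    case [simp]: (Suc i)
    define X where "X = qbinomial q (Suc m) (Suc i)"
    have X: "q ^ Suc i * qbinomial q m (Suc i) = X - qbinomial q m i"
      by (simp add: X_def)
    have "(1 - q ^ Suc j) * qbinomial q (Suc (Suc m)) (Suc j) =
        (1 - q ^ Suc j) * X + q ^ Suc j * ((1 - q ^ Suc j) * qbinomial q (Suc m) (Suc j))"
      by (simp add: X_def algebra_simps del: power_Suc)
    also have "(1 - q ^ Suc j) * qbinomial q (Suc m) (Suc j) = (1 - q ^ Suc m) * qbinomial q m j"
      by (rule Suc.IH)
    also have "q ^ Suc j * ((1 - q ^ Suc m) * qbinomial q m j) =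
        q * (1 - q ^ Suc m) * (q ^ Suc i * qbinomial q m (Suc i))"
      by (simp add: algebra_simps)
    also have "\<dots> = q * (1 - q ^ Suc m) * X - q * ((1 - q ^ Suc m) * qbinomial q m i)"
      unfolding X by (simp add: algebra_simps)
    also have "(1 - q ^ Suc m) * qbinomial q m i = (1 - q ^ Suc i) * X"
      unfolding X_def by (rule Suc.IH[symmetric])
    finally show ?thesis
      by (simp add: X_def[symmetric] algebra_simps del: qbinomial.simps)
  qed
qed

text \<open>The Pascal rule gives two alternating sums over row m + 1, one weighted by
  \<open>q ^ j\<close>. Their difference carries the factors \<open>1 - q ^ j\<close>, and
  absorption trades these for the constant \<open>1 - q ^ Suc m\<close> while lowering the row once
  more.\<close>

lemma alternating_qbinomial_sum_Suc_Suc: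
  "(\<Sum>j\<le>Suc (Suc m). (-1) ^ j * qbinomial q (Suc (Suc m)) j) =
     (1 - q ^ Suc m) * (\<Sum>j\<le>m. (-1) ^ j * qbinomial q m j)"
proof -
  let ?b = "qbinomial q (Suc m)"
  have "(\<Sum>j\<le>Suc (Suc m). (-1) ^ j * qbinomial q (Suc (Suc m)) j) =
      1 + (\<Sum>j\<le>Suc m. (-1) ^ Suc j * (?b j + q ^ Suc j * ?b (Suc j)))"
    by (subst sum.atMost_Suc_shift) simp
  also have "\<dots> = (1 + (\<Sum>j\<le>Suc m. (-1) ^ Suc j * q ^ Suc j * ?b (Suc j))) - (\<Sum>j\<le>Suc m. (-1) ^ j * ?b j)"
    by (simp only: ring_distribs sum.distrib) (simp add: sum_negf mult_ac)
  also have "1 + (\<Sum>j\<le>Suc m. (-1) ^ Suc j * q ^ Suc j * ?b (Suc j)) =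
      (\<Sum>j\<le>Suc (Suc m). (-1) ^ j * q ^ j * ?b j)"
    by (subst (2) sum.atMost_Suc_shift) simp
  also have "\<dots> = (\<Sum>j\<le>Suc m. (-1) ^ j * q ^ j * ?b j)"
    by (subst sum.atMost_Suc) (simp add: qbinomial_eq_0 del: qbinomial.simps)
  also have "\<dots> - (\<Sum>j\<le>Suc m. (-1) ^ j * ?b j) = - (\<Sum>j\<le>Suc m. (-1) ^ j * ((1 - q ^ j) * ?b j))"
    unfolding sum_subtractf[symmetric] sum_negf[symmetric] by (intro sum.cong refl) (simp add: algebra_simps)
  also have "(\<Sum>j\<le>Suc m. (-1) ^ j * ((1 - q ^ j) * ?b j)) =
      (\<Sum>j\<le>m. (-1) ^ Suc j * ((1 - q ^ Suc j) * ?b (Suc j)))"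
    by (subst sum.atMost_Suc_shift) simp
  also have "\<dots> = (\<Sum>j\<le>m. - (1 - q ^ Suc m) * ((-1) ^ j * qbinomial q m j))"
    by (simp only: qbinomial_absorption) (simp add: algebra_simps)
  also have "\<dots> = - (1 - q ^ Suc m) * (\<Sum>j\<le>m. (-1) ^ j * qbinomial q m j)"
    by (rule sum_distrib_left[symmetric])
  finally show ?thesis
    by (simp only: mult_minus_left minus_minus)
qed

lemma alternating_qbinomial_sum:
  "(\<Sum>j\<le>2 * h. (-1) ^ j * qbinomial q (2 * h) j) = (\<Prod>i<h. 1 - q ^ Suc (2 * i))"
proof (induction h)
  case (Suc h)
  then show ?case
    using alternating_qbinomial_sum_Suc_Suc[of q "2 * h"] by (simp add: mult.commute del: qbinomial.simps)
qed simp

text \<open>Here q has exact order \<open>n\<close>, so by absorption row \<open>n\<close> vanishes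
  in its interior. The Pascal rule then makes neighbours in row n - 1 differ by the factor - 1 /
  q^(j + 1), and the exponents 1 + ... + j accumulate to j (j + 1) / 2. The 2 in
  \<open>- 2 * a\<close> clears that denominator.\<close>

lemma qbinomial_unity_root:
  assumes "n > 0" "coprime (2 * a) (int n)" "j < n"
  shows "qbinomial (unity_root n (- 2 * a)) (n - 1) j = (-1) ^ j * unity_root n (a * int (j * Suc j))"
  using \<open>j < n\<close>
proof (induction j)
  case (Suc j)
  define q where "q = unity_root n (- 2 * a)"
  define m where "m = n - 1"
  have n: "n = Suc m"
    using assms by (simp add: m_def)
  have "\<not> int n dvd int (Suc j)"
    using Suc.prems by (simp only: int_dvd_int_iff) (auto dest: dvd_imp_le)
  moreover have "coprime (int n) (- 2 * a)"
    using assms by (simp add: coprime_commute)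
  ultimately have "\<not> int n dvd int (Suc j) * (- 2 * a)"
    by (simp add: coprime_dvd_mult_left_iff del: of_nat_Suc)
  then have ne: "q ^ Suc j \<noteq> 1"
    using assms(1) unity_root_eq_1_iff unfolding q_def unity_root_power by blast
  have "q ^ Suc m = 1"
    using assms by (simp only: q_def unity_root_power unity_root_eq_1_iff flip: n) simp
  then have "(1 - q ^ Suc j) * qbinomial q (Suc m) (Suc j) = 0"
    by (simp only: qbinomial_absorption diff_self mult_zero_left)
  with ne have "qbinomial q m j + q ^ Suc j * qbinomial q m (Suc j) = 0"
    by simp
  then have "qbinomial q m (Suc j) = - qbinomial q m j / q ^ Suc j"
    using ne by (simp add: q_def field_simps add_eq_0_iff)
  also have "qbinomial q m j = (-1) ^ j * unity_root n (a * int (j * Suc j))"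
    using Suc by (simp add: q_def m_def)
  also have "- ((-1) ^ j * unity_root n (a * int (j * Suc j))) / q ^ Suc j =
      (-1) ^ Suc j * (unity_root n (a * int (j * Suc j)) / unity_root n (int (Suc j) * (- 2 * a)))"
    by (simp only: q_def unity_root_power) simp
  also have "unity_root n (a * int (j * Suc j)) / unity_root n (int (Suc j) * (- 2 * a)) =
      unity_root n (a * int (Suc j * Suc (Suc j)))"
    unfolding unity_root_diff[symmetric] by (rule arg_cong[of _ _ "unity_root n"]) (simp add: algebra_simps)
  finally show ?case
    by (simp only: q_def m_def)
qed simp

text \<open>Row n - 1 at this root of unity has alternating terms with quadratic exponents, so its
  alternating sum is a Gauss sum up to a phase; the product formula for the same sum supplies the
  sines.\<close>

lemma gauss_sum_eq_sine_prod_odd: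
  assumes n: "n = Suc (2 * h)" and a: "coprime a (int n)"
  shows "gauss_sum a n = (\<Prod>i<h. 2 * \<i> * of_real (sin (2 * pi * real_of_int (a * int (Suc (2 * i))) / real n)))"
proof -
  define q where "q = unity_root n (- 2 * a)"
  have cop: "coprime (2 * a) (int n)"
    using a n by simp
  have "(\<Prod>i<h. 1 - q ^ Suc (2 * i)) = (\<Sum>j\<le>2 * h. (-1) ^ j * qbinomial q (2 * h) j)"
    by (rule alternating_qbinomial_sum[symmetric])
  also have "\<dots> = (\<Sum>j\<le>2 * h. unity_root n (a * int (j * Suc j)))"
  proof (intro sum.cong refl)
    fix j assume "j \<in> {..2 * h}"
    then have "qbinomial q (2 * h) j = (-1) ^ j * unity_root n (a * int (j * Suc j))"
      using qbinomial_unity_root[of n a j] cop n by (simp add: q_def)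
    then show "(-1) ^ j * qbinomial q (2 * h) j = unity_root n (a * int (j * Suc j))"
      by simp
  qed
  \<comment> \<open>Completing the square modulo \<open>n\<close>: since 2 (h + 1) = n + 1, the
    number h + 1 is the inverse of 2.\<close>
  also have "\<dots> = (\<Sum>j\<le>2 * h. unity_root n (a * (int j + int (Suc h))\<^sup>2) / unity_root n (a * (int (Suc h))\<^sup>2))"
    unfolding unity_root_diff[symmetric]
  proof (intro sum.cong refl unity_root_cong)
    fix j
    show "[a * int (j * Suc j) = a * (int j + int (Suc h))\<^sup>2 - a * (int (Suc h))\<^sup>2] (mod int n)"
      by (subst cong_iff_dvd_diff, rule dvdI[of _ _ "- a * int j"])
         (simp add: n power2_eq_square algebra_simps)
  qed
  also have "\<dots> = (\<Sum>j\<le>2 * h. unity_root n (a * (int j + int (Suc h))\<^sup>2)) / unity_root n (a * (int (Suc h))\<^sup>2)"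
    by (rule sum_divide_distrib[symmetric])
  also have "(\<Sum>j\<le>2 * h. unity_root n (a * (int j + int (Suc h))\<^sup>2)) = gauss_sum a n"
    unfolding gauss_sum_def
  proof (rule sum_complete_residues)
    fix i j assume "i \<in> {..2 * h}" "j \<in> {..2 * h}" "[int i + int (Suc h) = int j + int (Suc h)] (mod int n)"
    moreover from this have "[int i = int j] (mod int n)"
      using cong_add_rcancel by blast
    ultimately show "i = j"
      using cong_int_interval_imp_eq[of "int i" "int j" n] n by auto
  qed (auto simp: n intro!: unity_root_cong cong_scalar_left cong_pow)
  finally have G: "gauss_sum a n = unity_root n (a * (int (Suc h))\<^sup>2) * (\<Prod>i<h. 1 - q ^ Suc (2 * i))"
    by simp
  have "1 - q ^ Suc (2 * i) = unity_root n (- a * int (Suc (2 * i))) *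
      (2 * \<i> * of_real (sin (2 * pi * real_of_int (a * int (Suc (2 * i))) / real n)))" for i
  proof -
    define y where "y = a * int (Suc (2 * i))"
    have "2 * \<i> * of_real (sin (2 * pi * real_of_int y / real n)) = unity_root n y - unity_root n (- y)"
      by (simp add: complex_eq_iff unity_root_def)
    then have "unity_root n (- y) * (2 * \<i> * of_real (sin (2 * pi * real_of_int y / real n))) =
        unity_root n (- y + y) - unity_root n (- y + - y)"
      by (simp only: unity_root_add ring_distribs)
    also have "\<dots> = 1 - q ^ Suc (2 * i)"
      by (simp only: q_def unity_root_power) (simp add: y_def algebra_simps)
    finally show ?thesis
      by (simp add: y_def)
  qed
  then have "(\<Prod>i<h. 1 - q ^ Suc (2 * i)) = (\<Prod>i<h. unity_root n (- a * int (Suc (2 * i)))) *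
      (\<Prod>i<h. 2 * \<i> * of_real (sin (2 * pi * real_of_int (a * int (Suc (2 * i))) / real n)))"
    by (simp only: prod.distrib)
  \<comment> \<open>The odd numbers below 2 h add up to h^2, and (h + 1)^2 - h^2 = n, so all phases
    together cancel.\<close>
  also have "(\<Prod>i<h. unity_root n (- a * int (Suc (2 * i)))) = unity_root n (- a * (int h)\<^sup>2)"
    by (induction h) (simp_all add: unity_root_add[symmetric] power2_eq_square algebra_simps)
  finally have "gauss_sum a n = unity_root n (a * (int (Suc h))\<^sup>2 + - a * (int h)\<^sup>2) *
      (\<Prod>i<h. 2 * \<i> * of_real (sin (2 * pi * real_of_int (a * int (Suc (2 * i))) / real n)))"
    unfolding G by (simp only: unity_root_add mult.assoc)
  also have "a * (int (Suc h))\<^sup>2 + - a * (int h)\<^sup>2 = a * int n"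
    by (simp add: n power2_eq_square algebra_simps)
  also have "unity_root n \<dots> = 1"
    using n by (subst unity_root_eq_1_iff) auto
  finally show ?thesis by simp
qed

text \<open>The reflection of k to 2 h + 1 - k carries the odd indices above \<open>h\<close> to the
  even indices from 2 up to \<open>h\<close>. There are \<open>h div 2\<close> of them, each costing
  one sign.\<close>

lemma prod_odd_reflect:
  fixes f :: "nat \<Rightarrow> 'a :: comm_ring_1"
  assumes "\<And>k. k \<le> 2 * h + 1 \<Longrightarrow> f (2 * h + 1 - k) = - f k"
  shows "(\<Prod>i<h. f (Suc (2 * i))) = (-1) ^ (h div 2) * (\<Prod>l=1..h. f l)"
proof -
  define r where "r = (h + 1) div 2"
  have r: "h = r + h div 2"
    unfolding r_def by presburger
  have split: "(\<Prod>i<(h + 1) div 2. f (Suc (2 * i))) * (\<Prod>l=1..h div 2. f (2 * l)) = (\<Prod>l=1..h. f l)" for h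
  proof (induction h)
    case (Suc h)
    show ?case
    proof (cases "even h")
      case True
      then obtain t where "h = 2 * t" by (elim evenE)
      with Suc show ?thesis by (simp add: mult_ac)
    next
      case False
      then obtain t where "h = 2 * t + 1" by (elim oddE)
      with Suc show ?thesis by (simp add: mult_ac)
    qed
  qed simp
  have "(\<Prod>i<h. f (Suc (2 * i))) = (\<Prod>i<r. f (Suc (2 * i))) * (\<Prod>i\<in>{r..<h}. f (Suc (2 * i)))"
    using r by (subst prod.union_disjoint[symmetric]) (auto intro!: prod.cong)
  also have "(\<Prod>i\<in>{r..<h}. f (Suc (2 * i))) = (\<Prod>l=1..h div 2. - f (2 * l))"
  proof (rule prod.reindex_bij_witness[where i = "\<lambda>l. h - l" and j = "\<lambda>i. h - i"])
    fix i assume "i \<in> {r..<h}"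
    then show "- f (2 * (h - i)) = f (Suc (2 * i))"
      using assms[of "2 * (h - i)"] by (simp add: algebra_simps)
  qed (use r in auto)
  also have "\<dots> = (-1) ^ (h div 2) * (\<Prod>l=1..h div 2. f (2 * l))"
  proof -
    have "(\<Prod>l=1..k. - f (2 * l)) = (-1) ^ k * (\<Prod>l=1..k. f (2 * l))" for k
      by (induction k) (simp_all add: mult_ac)
    then show ?thesis .
  qed
  also have "(\<Prod>i<r. f (Suc (2 * i))) * ((-1) ^ (h div 2) * (\<Prod>l=1..h div 2. f (2 * l))) =
      (-1) ^ (h div 2) * ((\<Prod>i<r. f (Suc (2 * i))) * (\<Prod>l=1..h div 2. f (2 * l)))"
    by (simp add: mult_ac)
  also have "(\<Prod>i<r. f (Suc (2 * i))) * (\<Prod>l=1..h div 2. f (2 * l)) = (\<Prod>l=1..h. f l)"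
    unfolding r_def by (rule split)
  finally show ?thesis .
qed

text \<open>The indices are brought into 1..h because there 2 l < n, so for small multipliers the
  sign of every sine can be read off.\<close>

lemma gauss_sum_eq_sine_prod:
  assumes n: "n = 2 * h + 1" and a: "coprime a (int n)"
  shows "gauss_sum a n = \<i> ^ h * (-1) ^ (h div 2) *
    of_real (\<Prod>l=1..h. 2 * sin (2 * pi * real_of_int a * real l / real n))"
proof -
  define f where "f l = 2 * sin (2 * pi * real_of_int a * real l / real n)" for l
  have "f (2 * h + 1 - k) = - f k" if "k \<le> 2 * h + 1" for k
  proof -
    have "2 * pi * real_of_int a * real (n - k) / real n =
        2 * pi * real_of_int a - 2 * pi * real_of_int a * real k / real n"
      using that n by (simp add: of_nat_diff field_simps)
    then have "sin (2 * pi * real_of_int a * real (n - k) / real n) =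
        - sin (2 * pi * real_of_int a * real k / real n)"
      by (simp add: sin_diff sin_int_2pin cos_int_2pin)
    then show ?thesis by (simp add: f_def n)
  qed
  then have "(\<Prod>i<h. f (Suc (2 * i))) = (-1) ^ (h div 2) * (\<Prod>l=1..h. f l)"
    by (rule prod_odd_reflect)
  moreover have "gauss_sum a n = (\<Prod>i<h. \<i> * of_real (f (Suc (2 * i))))"
    unfolding f_def using gauss_sum_eq_sine_prod_odd[of n h a] assms by (simp add: mult_ac)
  then have "gauss_sum a n = \<i> ^ h * of_real (\<Prod>i<h. f (Suc (2 * i)))"
    by (simp add: prod.distrib)
  ultimately show ?thesis
    by (simp add: f_def mult_ac)
qed

subsection \<open>Absolute value and sign\<close>

text \<open>In the double sum for the squared norm, x = t + y makes the sum over y a character sum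
  with frequency 2 k t. As 2 k is invertible modulo \<open>n\<close>, only t = 0 survives.\<close>

lemma norm_gauss_sum:
  assumes "odd n" "coprime k (int n)"
  shows "norm (gauss_sum k n) = sqrt (real n)"
proof -
  have n: "n > 0" using assms(1) by (cases n) auto
  have "gauss_sum k n * cnj (gauss_sum k n) =
      (\<Sum>y\<in>{0..<int n}. \<Sum>x\<in>{0..<int n}. unity_root n (k * (x\<^sup>2 - y\<^sup>2)))"
    unfolding gauss_sum_def
    by (subst sum.swap)
       (simp add: cnj_sum cnj_unity_root sum_product unity_root_add[symmetric] algebra_simps)
  also have "\<dots> = (\<Sum>y\<in>{0..<int n}. \<Sum>t\<in>{0..<int n}. unity_root n (k * ((t + y)\<^sup>2 - y\<^sup>2)))"
  proof (rule sum.cong[OF refl])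
    fix y
    show "(\<Sum>x\<in>{0..<int n}. unity_root n (k * (x\<^sup>2 - y\<^sup>2))) =
        (\<Sum>t\<in>{0..<int n}. unity_root n (k * ((t + y)\<^sup>2 - y\<^sup>2)))"
    proof (rule sum_complete_residues[symmetric])
      fix a b assume "a \<in> {0..<int n}" "b \<in> {0..<int n}" "[a + y = b + y] (mod int n)"
      then show "a = b"
        using cong_add_rcancel cong_int_interval_imp_eq by blast
    qed (use n in \<open>auto intro!: unity_root_cong cong_scalar_left cong_pow cong_diff\<close>)
  qed
  also have "\<dots> = (\<Sum>t\<in>{0..<int n}. unity_root n (k * t\<^sup>2) * (\<Sum>y\<in>{0..<int n}. unity_root n (2 * k * t * y)))"
    by (subst sum.swap)
       (simp add: sum_distrib_left unity_root_add[symmetric] power2_eq_square algebra_simps)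
  also have "\<dots> = (\<Sum>t\<in>{0..<int n}. if t = 0 then of_nat n else 0)"
  proof (intro sum.cong refl)
    fix t assume t: "t \<in> {0..<int n}"
    have "coprime (int n) (2 * k)"
      using assms by (simp add: coprime_commute)
    then have "int n dvd 2 * k * t \<longleftrightarrow> int n dvd t"
      by (rule coprime_dvd_mult_right_iff)
    also have "\<dots> \<longleftrightarrow> t = 0"
      using t by (auto dest: zdvd_imp_le)
    finally show "unity_root n (k * t\<^sup>2) * (\<Sum>y\<in>{0..<int n}. unity_root n (2 * k * t * y)) =
        (if t = 0 then of_nat n else 0)"
      using n by (simp add: sum_unity_root)
  qed
  also have "\<dots> = of_nat n"
    using n by simp
  finally have "of_real ((norm (gauss_sum k n))\<^sup>2) = (of_real (real n) :: complex)"
    by (simp only: complex_norm_square of_real_of_nat_eq)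
  then have "(norm (gauss_sum k n))\<^sup>2 = real n"
    by (simp only: of_real_eq_iff)
  then show ?thesis
    by (metis norm_ge_zero real_sqrt_unique)
qed

lemma gauss_sum_nonzero: "odd n \<Longrightarrow> coprime k (int n) \<Longrightarrow> gauss_sum k n \<noteq> 0"
  using norm_gauss_sum[of n k] by (cases n) auto

text \<open>The norm fixes the sine product up to sign, so counting negative sines is enough to
  evaluate the Gauss sum.\<close>

lemma gauss_sum_sign:
  assumes n: "n = 2 * h + 1" and "coprime a (int n)"
    and s: "s \<in> {1, -1}"
    and pos: "s * (\<Prod>l=1..h. 2 * sin (2 * pi * real_of_int a * real l / real n)) > 0"
  shows "gauss_sum a n = \<i> ^ h * (-1) ^ (h div 2) * of_real (s * sqrt (real n))"
proof -
  define P where "P = (\<Prod>l=1..h. 2 * sin (2 * pi * real_of_int a * real l / real n))"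
  have eq: "gauss_sum a n = \<i> ^ h * (-1) ^ (h div 2) * of_real P"
    using gauss_sum_eq_sine_prod[of n h a] assms by (simp add: P_def)
  have "\<bar>P\<bar> = norm (gauss_sum a n)"
    unfolding eq by (simp add: norm_mult norm_power)
  also have "\<dots> = sqrt (real n)"
    using assms by (intro norm_gauss_sum) auto
  finally have "\<bar>P\<bar> = sqrt (real n)" .
  moreover have "s * P > 0"
    using pos by (simp only: P_def)
  ultimately have "P = s * sqrt (real n)"
    using s by auto
  with eq show ?thesis by simp
qed

text \<open>All angles 2 \<pi> l / n with l \<le> h lie between 0 and \<pi>, so every sine is
  positive. The remaining prefactor is 1 for even h and \<i> for odd h.\<close>

lemma gauss_sum_one:
  assumes "odd n"
  shows "gauss_sum 1 n = (if [n = 1] (mod 4) then 1 else \<i>) * of_real (sqrt (real n))"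
proof -
  obtain h where n: "n = 2 * h + 1"
    using assms by (elim oddE)
  have "gauss_sum 1 n = \<i> ^ h * (-1) ^ (h div 2) * of_real (1 * sqrt (real n))"
  proof (rule gauss_sum_sign)
    show "1 * (\<Prod>l=1..h. 2 * sin (2 * pi * real_of_int 1 * real l / real n)) > 0"
    proof (simp only: mult_1_left, rule prod_pos)
      fix l assume l: "l \<in> {1..h}"
      have "2 * pi * real l < pi * real n"
        using l n by simp
      then have "2 * pi * real_of_int 1 * real l / real n < pi"
        using n by (simp add: field_simps)
      then show "0 < 2 * sin (2 * pi * real_of_int 1 * real l / real n)"
        using l n by (intro mult_pos_pos sin_gt_zero) auto
    qed
  qed (use n in auto)
  also have "\<i> ^ h * (-1) ^ (h div 2) = (if [n = 1] (mod 4) then 1 else \<i>)"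
  proof (cases "even h")
    case True
    then obtain t where "h = 2 * t" by (elim evenE)
    then show ?thesis
      by (simp add: n cong_def power_mult power_mult_distrib[symmetric])
  next
    case False
    then obtain t where "h = 2 * t + 1" by (elim oddE)
    then show ?thesis
      by (simp add: n cong_def power_mult power_mult_distrib[symmetric] mod_Suc mod_mult2_eq)
  qed
  finally show ?thesis by simp
qed

text \<open>With n = 4 t + 3 and h = 2 t + 1 the angles 4 \<pi> l / n are below \<pi> for l \<le> t
  and between \<pi> and 2 \<pi> for the other t + 1 indices. The sign is therefore (-1)^(t + 1),
  which depends on n modulo 8.\<close>

lemma gauss_sum_two:
  assumes "[n = 3] (mod 4)"
  shows "gauss_sum 2 n = (if [n = 7] (mod 8) then 1 else -1) * gauss_sum 1 n"
proof -
  have n4: "n = 2 * (2 * (n div 4) + 1) + 1"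
    using assms unfolding cong_def by presburger
  define t where "t = n div 4"
  define h where "h = 2 * t + 1"
  have n: "n = 2 * h + 1"
    using n4 by (simp add: h_def t_def)
  have "gauss_sum 2 n = \<i> ^ h * (-1) ^ (h div 2) * of_real ((-1) ^ Suc t * sqrt (real n))"
  proof (rule gauss_sum_sign)
    define f where "f l = 2 * sin (2 * pi * real_of_int 2 * real l / real n)" for l
    have "(\<Prod>l=1..h. f l) = (\<Prod>l=1..t. f l) * (\<Prod>l=t+1..h. f l)"
    proof -
      have "{1..h} = {1..t} \<union> {t+1..h}"
        by (auto simp: h_def)
      then show ?thesis
        by (simp only:) (rule prod.union_disjoint, auto)
    qed
    also have "(\<Prod>l=t+1..h. f l) = (\<Prod>l=t+1..h. (-1) * (- f l))"
      by simp
    also have "\<dots> = (-1) ^ Suc t * (\<Prod>l=t+1..h. - f l)"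
      by (subst prod.distrib) (simp add: h_def)
    finally have "(-1) ^ Suc t * (\<Prod>l=1..h. f l) = (\<Prod>l=1..t. f l) * (\<Prod>l=t+1..h. - f l)"
      by (simp add: power_mult_distrib[symmetric] mult_ac)
    also have "\<dots> > 0"
    proof (intro mult_pos_pos prod_pos ballI)
      fix l assume l: "l \<in> {1..t}"
      have "2 * pi * 2 * real l < pi * real n"
        using l by (simp add: n h_def)
      then have "2 * pi * real_of_int 2 * real l / real n < pi"
        using n by (simp add: field_simps)
      then show "f l > 0"
        unfolding f_def using l n by (intro mult_pos_pos sin_gt_zero) auto
    next
      fix l assume l: "l \<in> {t+1..h}"
      have "pi * real n < 2 * pi * 2 * real l" "2 * pi * 2 * real l < 2 * pi * real n"
        using l by (auto simp: n h_def)
      then have "pi < 2 * pi * real_of_int 2 * real l / real n" "2 * pi * real_of_int 2 * real l / real n < 2 * pi"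
        using n by (simp_all add: field_simps)
      then have "sin (2 * pi * real_of_int 2 * real l / real n) < 0"
        by (rule sin_lt_zero)
      then show "- f l > 0"
        by (simp add: f_def)
    qed
    finally show "(-1) ^ Suc t * (\<Prod>l=1..h. 2 * sin (2 * pi * real_of_int 2 * real l / real n)) > 0"
      by (simp only: f_def)
    show "(-1) ^ Suc t \<in> {1, -1 :: real}"
      by (cases "even t") auto
  qed (use n in auto)
  also have "\<i> ^ h * (-1) ^ (h div 2) = \<i>"
    by (simp add: h_def power_mult power_mult_distrib[symmetric])
  also have "\<i> * of_real ((-1) ^ Suc t * sqrt (real n)) = (-1) ^ Suc t * gauss_sum 1 n"
  proof -
    have "odd n" "\<not> [n = 1] (mod 4)"
      using assms n by (auto simp: cong_def)
    then show ?thesis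
      by (simp add: gauss_sum_one)
  qed
  also have "(-1) ^ Suc t = (if [n = 7] (mod 8) then 1 else -1 :: complex)"
  proof (cases "even t")
    case True
    then have "n mod 8 \<noteq> 7" unfolding n h_def by presburger
    then show ?thesis using True by (simp add: cong_def)
  next
    case False
    then have "n mod 8 = 7" unfolding n h_def by presburger
    then show ?thesis using False by (simp add: cong_def)
  qed
  finally show ?thesis .
qed

text \<open>Here h = (n - 1) / 2 is even, so the prefactor of the sine product is 1.\<close>

lemma Im_gauss_sum_cong_1_mod_4:
  assumes "[n = 1] (mod 4)" "coprime a (int n)"
  shows "Im (gauss_sum a n) = 0"
proof -
  have n: "n = 2 * (2 * (n div 4)) + 1"
    using assms(1) unfolding cong_def by presburger
  define P where "P = (\<Prod>l=1..2 * (n div 4). 2 * sin (2 * pi * real_of_int a * real l / real n))"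
  have "gauss_sum a n = \<i> ^ (2 * (n div 4)) * (-1) ^ (2 * (n div 4) div 2) * of_real P"
    unfolding P_def by (rule gauss_sum_eq_sine_prod) fact+
  also have "\<dots> = of_real P"
    by (simp add: power_mult power_mult_distrib[symmetric])
  finally show ?thesis by simp
qed

text \<open>The prefactor of the sine product does not depend on \<open>a\<close>, and both real
  products have absolute value sqrt n.\<close>

lemma gauss_sum_eq_or_minus:
  assumes "odd n" "coprime a (int n)"
  shows "gauss_sum a n = gauss_sum 1 n \<or> gauss_sum a n = - gauss_sum 1 n"
proof -
  obtain h where n: "n = 2 * h + 1"
    using assms(1) by (elim oddE)
  define P where "P a = (\<Prod>l=1..h. 2 * sin (2 * pi * real_of_int a * real l / real n))" for a
  have eq: "gauss_sum b n = \<i> ^ h * (-1) ^ (h div 2) * of_real (P b)" if "coprime b (int n)" for b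
    unfolding P_def by (rule gauss_sum_eq_sine_prod) fact+
  have "\<bar>P b\<bar> = sqrt (real n)" if "coprime b (int n)" for b
    using norm_gauss_sum[OF assms(1) that] eq[OF that] by (simp add: norm_mult norm_power)
  from this[of a] this[of 1] have "P a = P 1 \<or> P a = - P 1"
    using assms(2) by (auto simp: abs_eq_iff)
  then show ?thesis
    using eq[of a] eq[of 1] assms(2) by auto
qed

subsection \<open>Gauss sums and the Kronecker symbol\<close>

lemma cong_signs_imp_eq:
  fixes a b m :: int
  assumes "[a = b] (mod m)" "m > 2" "a \<in> {-1, 0, 1}" "b \<in> {-1, 0, 1}"
  shows "a = b"
proof -
  have "m dvd a - b"
    using assms(1) by (simp add: cong_iff_dvd_diff)
  moreover have "\<bar>a - b\<bar> < m"
    using assms by auto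
  ultimately show ?thesis
    using dvd_imp_le_int[of "a - b" m] by fastforce
qed

text \<open>Euler's criterion is multiplicative modulo \<open>p\<close>, and a congruence between
  values in {-1, 0, 1} is an equality once p > 2.\<close>

lemma Legendre_mult:
  fixes p :: nat
  assumes "prime p" "2 < p"
  shows "Legendre (a * b) p = Legendre a p * Legendre b p"
proof (rule cong_signs_imp_eq)
  have "[Legendre (a * b) p = a ^ ((p - 1) div 2) * b ^ ((p - 1) div 2)] (mod int p)"
    using euler_criterion[OF assms, of "a * b"] by (simp add: power_mult_distrib)
  also have "[a ^ ((p - 1) div 2) * b ^ ((p - 1) div 2) = Legendre a p * Legendre b p] (mod int p)"
    by (intro cong_mult cong_sym[OF euler_criterion] assms)
  finally show "[Legendre (a * b) p = Legendre a p * Legendre b p] (mod int p)" .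
qed (use assms in \<open>auto simp: Legendre_def\<close>)

lemma Legendre_minus_one:
  fixes p :: nat
  assumes "prime p" "2 < p"
  shows "Legendre (- 1) p = (if [p = 1] (mod 4) then 1 else - 1)"
proof -
  have odd: "odd p"
    using assms prime_odd_nat by auto
  have "Legendre (- 1) p = (- 1) ^ ((p - 1) div 2)"
    by (rule cong_signs_imp_eq[OF euler_criterion[OF assms]])
       (use assms in \<open>auto simp: Legendre_def minus_one_power_iff\<close>)
  moreover have "even ((p - 1) div 2) \<longleftrightarrow> [p = 1] (mod 4)"
    using odd unfolding cong_def by presburger
  ultimately show ?thesis
    by (simp add: minus_one_power_iff)
qed

lemma gauss_sum_quadratic_residue:
  assumes "n > 0" "coprime k (int n)" "QuadRes (int n) k"
  shows "gauss_sum k n = gauss_sum 1 n"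
proof -
  obtain y where y: "[y\<^sup>2 = k] (mod int n)"
    using assms(3) by (auto simp: QuadRes_def)
  then have "coprime (y\<^sup>2) (int n)"
    using assms(2) cong_imp_coprime cong_sym by blast
  then have "coprime y (int n)"
    by simp
  then show ?thesis
    using gauss_sum_mult_square[of n y 1] gauss_sum_cong[OF y] assms(1) by simp
qed

text \<open>Summed over all j first, the character has frequency x^2 and survives only at x = 0, for
  a total of \<open>p\<close>. The term j = 0 alone already equals \<open>p\<close>.\<close>

lemma sum_gauss_sum_prime:
  assumes "prime p"
  shows "(\<Sum>j\<in>{1..<int p}. gauss_sum j p) = 0"
proof -
  have p: "p > 0"
    using assms by (simp add: prime_gt_0_nat)
  have "(\<Sum>j\<in>{0..<int p}. gauss_sum j p) =
      (\<Sum>x\<in>{0..<int p}. \<Sum>j\<in>{0..<int p}. unity_root p (x\<^sup>2 * j))"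
    unfolding gauss_sum_def by (subst sum.swap) (simp add: mult.commute)
  also have "\<dots> = (\<Sum>x\<in>{0..<int p}. if x = 0 then of_nat p else 0)"
  proof (intro sum.cong refl)
    fix x assume x: "x \<in> {0..<int p}"
    have "int p dvd x\<^sup>2 \<longleftrightarrow> int p dvd x"
      using assms by (simp add: prime_dvd_power_iff)
    also have "\<dots> \<longleftrightarrow> x = 0"
      using x by (auto dest: zdvd_imp_le)
    finally show "(\<Sum>j\<in>{0..<int p}. unity_root p (x\<^sup>2 * j)) = (if x = 0 then of_nat p else 0)"
      using p by (simp add: sum_unity_root)
  qed
  also have "\<dots> = of_nat p"
    using p by simp
  also have "{0..<int p} = insert 0 {1..<int p}"
    using p by auto
  finally show ?thesis
    by (simp add: gauss_sum_def)
qed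

lemma gauss_sum_prime:
  assumes p: "prime p" "odd p" and k: "coprime k (int p)"
  shows "gauss_sum k p = of_int (Legendre k (int p)) * gauss_sum 1 p"
proof -
  have p2: "2 < p"
    using p prime_ge_2_nat[of p] by (cases "p = 2") auto
  have L: "Legendre j p = (if QuadRes p j then 1 else - 1)" if "coprime j (int p)" for j
  proof -
    have "\<not> int p dvd j"
    proof
      assume "int p dvd j"
      then have "is_unit (int p)"
        using that by (meson coprime_common_divisor dvd_refl)
      then show False using p2 by simp
    qed
    then show ?thesis by (simp add: Legendre_def cong_0_iff)
  qed
  show ?thesis
  proof (cases "QuadRes p k")
    case True
    then show ?thesis
      using gauss_sum_quadratic_residue[of p k] k p2 by (simp add: L)
  next
    case nonres: False
    \<comment> \<open>If one nonresidue gave \<open>G(1, p)\<close>, then so would all of them, and the sums \<open>G(j, p)\<close> could not add up to \<open>0\<close>.\<close>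
    have "gauss_sum k p \<noteq> gauss_sum 1 p"
    proof
      assume eq: "gauss_sum k p = gauss_sum 1 p"
      have "gauss_sum j p = gauss_sum 1 p" if "j \<in> {1..<int p}" for j
      proof -
        have j: "coprime j (int p)"
          using that p(1) zdvd_not_zless[of j "int p"]
          by (subst coprime_commute) (auto intro!: prime_imp_coprime)
        show ?thesis
        proof (cases "QuadRes p j")
          case True
          then show ?thesis
            using gauss_sum_quadratic_residue[of p j] j p2 by simp
        next
          case False
          have "Legendre (j * k) p = Legendre j p * Legendre k p"
            using p(1) p2 by (rule Legendre_mult)
          also have "\<dots> = 1"
            using False nonres j k by (simp only: L) simp
          finally have "Legendre (j * k) p = 1" .
          then have "QuadRes p (j * k)"
            by (auto simp: Legendre_def split: if_splits)
          then obtain u where u: "[u\<^sup>2 = j * k] (mod int p)"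
            by (auto simp: QuadRes_def)
          have "coprime (j * k) (int p)"
            using j k by simp
          then have "coprime (u\<^sup>2) (int p)"
            using u cong_imp_coprime cong_sym by blast
          then have cu: "coprime u (int p)"
            by simp
          \<comment> \<open>A product of two nonresidues is a square u^2, so j k^2 is congruent to k
            u^2, and j and k differ only by square factors.\<close>
          have "gauss_sum j p = gauss_sum (j * k\<^sup>2) p"
            using gauss_sum_mult_square[of p k j] k p2 by simp
          also have "\<dots> = gauss_sum (k * u\<^sup>2) p"
          proof (rule gauss_sum_cong)
            have "[k * u\<^sup>2 = k * (j * k)] (mod int p)"
              using u by (rule cong_scalar_left)
            then show "[j * k\<^sup>2 = k * u\<^sup>2] (mod int p)"
              by (simp add: power2_eq_square cong_sym mult_ac)
          qed
          also have "\<dots> = gauss_sum k p"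
            using cu p2 by (intro gauss_sum_mult_square) auto
          finally show ?thesis using eq by simp
        qed
      qed
      then have "(\<Sum>j\<in>{1..<int p}. gauss_sum j p) = (\<Sum>j\<in>{1..<int p}. gauss_sum 1 p)"
        by (intro sum.cong refl)
      also have "\<dots> = of_nat (p - 1) * gauss_sum 1 p"
        using p2 by (simp add: nat_diff_distrib)
      finally have "(\<Sum>j\<in>{1..<int p}. gauss_sum j p) = of_nat (p - 1) * gauss_sum 1 p" .
      with sum_gauss_sum_prime[OF p(1)] have "gauss_sum 1 p = 0"
        using p2 by auto
      then show False
        using gauss_sum_nonzero[of p 1] p by simp
    qed
    then have "gauss_sum k p = - gauss_sum 1 p"
      using gauss_sum_eq_or_minus[of p k] p k by auto
    then show ?thesis
      using nonres k by (simp add: L)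
  qed
qed

text \<open>This is the multiplicativity of G(k, n) / G(1, n) in k, multiplied out. A prime p is
  split off n: if p^2 divides n, each of the four sums gains the factor p; otherwise the sums factor
  over p and n / p, where the Legendre symbol and the induction hypothesis apply.\<close>

lemma gauss_sum_mult:
  assumes "odd n" "coprime k (int n)" "coprime l (int n)"
  shows "gauss_sum (k * l) n * gauss_sum 1 n = gauss_sum k n * gauss_sum l n"
  using assms
proof (induction n arbitrary: k l rule: less_induct)
  case (less n)
  show ?case
  proof (cases "n = 1")
    case False
    then obtain p where p: "prime p" "p dvd n"
      using prime_factor_nat by blast
    from p(2) obtain m where m: "n = p * m"
      by (elim dvdE)
    have odd: "odd p" "odd m"
      using less.prems(1) m by auto
    have p2: "2 < p"
      using p(1) odd prime_ge_2_nat[of p] by (cases "p = 2") auto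
    have m0: "m > 0"
      using odd by (cases m) auto
    have cop: "coprime k (int p)" "coprime k (int m)" "coprime l (int p)" "coprime l (int m)"
      using less.prems m by auto
    show ?thesis
    proof (cases "p dvd m")
      case True
      then obtain m' where m': "m = p * m'"
        by (elim dvdE)
      have n: "n = p\<^sup>2 * m'"
        by (simp add: m m' power2_eq_square)
      have "m' < m"
        using m' m0 p2 by auto
      also have "m < n"
        using m m0 p2 by simp
      finally have lt: "m' < n" .
      have IH: "gauss_sum (k * l) m' * gauss_sum 1 m' = gauss_sum k m' * gauss_sum l m'"
        using cop odd m' lt by (intro less.IH) auto
      have eq: "gauss_sum j n = of_nat p * gauss_sum j m'" if "coprime j (int p)" for j
        unfolding n using that p(1) odd(1) m' m0 by (intro gauss_sum_prime_square) auto
      show ?thesis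
        using cop IH by (simp add: eq)
    next
      case False
      then have pm: "coprime p m"
        using p(1) by (simp add: prime_imp_coprime)
      then have pm': "coprime (int p) (int m)" "coprime (int m) (int p)"
        by (auto simp: coprime_commute)
      have eq: "gauss_sum j n = gauss_sum (j * int p) m * gauss_sum (j * int m) p" for j
        unfolding m using pm p2 m0 by (intro gauss_sum_mult_modulus) auto
      have lt: "m < n"
        using m m0 p2 by simp
      \<comment> \<open>Factoring the modulus puts an extra \<open>int p\<close> into every
        multiplier. The hypothesis is therefore used twice, for the pairs (k l p, p) and (k p, l p),
        which have the same product.\<close>
      have A: "gauss_sum (k * l * int p) m * gauss_sum (int p) m =
          gauss_sum (k * int p) m * gauss_sum (l * int p) m"
      proof -
        have "gauss_sum (k * l * int p) m * gauss_sum (int p) m = gauss_sum (k * l * int p * int p) m * gauss_sum 1 m"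
          using cop odd lt pm' by (intro less.IH[symmetric]) auto
        also have "k * l * int p * int p = (k * int p) * (l * int p)"
          by simp
        also have "gauss_sum \<dots> m * gauss_sum 1 m = gauss_sum (k * int p) m * gauss_sum (l * int p) m"
          using cop odd lt pm' by (intro less.IH) auto
        finally show ?thesis .
      qed
      have B: "gauss_sum (k * l * int m) p * gauss_sum (int m) p =
          gauss_sum (k * int m) p * gauss_sum (l * int m) p"
      proof -
        have g: "gauss_sum (j * int m) p = of_int (Legendre j p) * of_int (Legendre (int m) p) * gauss_sum 1 p"
          if "coprime j (int p)" for j
          using gauss_sum_prime[of p "j * int m"] that pm' p(1) odd(1) Legendre_mult[OF p(1) p2, of j "int m"]
          by simp
        have "gauss_sum (int m) p = of_int (Legendre (int m) p) * gauss_sum 1 p"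
          using pm' p(1) odd(1) by (intro gauss_sum_prime) auto
        moreover have "coprime (k * l) (int p)"
          using cop by simp
        ultimately show ?thesis
          using cop Legendre_mult[OF p(1) p2, of k l] by (simp add: g)
      qed
      have "gauss_sum (k * l) n * gauss_sum 1 n =
          (gauss_sum (k * l * int p) m * gauss_sum (int p) m) * (gauss_sum (k * l * int m) p * gauss_sum (int m) p)"
        by (simp only: eq mult_1_left mult.assoc mult.left_commute)
      also have "\<dots> = gauss_sum k n * gauss_sum l n"
        unfolding A B by (simp only: eq mult.assoc mult.left_commute)
      finally show ?thesis .
    qed
  qed simp
qed

section \<open>The Kronecker symbol at positive lower arguments\<close>

lemma kronecker_eq_prod_mset:
  "n > 0 \<Longrightarrow> kronecker a n = prod_mset (image_mset (kronecker_prime a) (prime_factorization n))"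
  by (auto simp: kronecker_def image_prod_mset_multiplicity count_prime_factorization intro!: prod.cong)

lemma kronecker_one [simp]: "kronecker a 1 = 1"
  by (simp add: kronecker_eq_prod_mset)

lemma kronecker_prime_mult:
  assumes "prime p" "n > 0"
  shows "kronecker a (p * n) = kronecker_prime a p * kronecker a n"
  using assms prime_gt_0_int[of p]
  by (simp add: kronecker_eq_prod_mset prime_factorization_mult prime_factorization_prime)

lemma kronecker_eq_0:
  assumes "n > 0" "odd a" "\<not> coprime n a"
  shows "kronecker a n = 0"
proof -
  obtain p where p: "prime p" "p dvd gcd n a"
    using assms by (metis coprime_iff_gcd_eq_1 gcd_eq_0_iff is_unit_gcd less_irrefl prime_divisor_exists)
  then have "p dvd n" "p dvd a"
    by auto
  then have "p \<noteq> 2"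
    using assms(2) by auto
  then have "kronecker_prime a p = 0"
    using \<open>p dvd a\<close> by (simp add: kronecker_prime_def Legendre_def cong_0_iff)
  moreover obtain m where m: "n = p * m"
    using \<open>p dvd n\<close> by (elim dvdE)
  moreover have "m > 0"
    using m assms(1) p(1) prime_gt_0_int[of p] by (simp add: zero_less_mult_iff)
  ultimately show ?thesis
    using p(1) by (simp add: kronecker_prime_mult)
qed

text \<open>For odd q, G(q, d) G(d, q) = G(1, q d) and G(d, q) = (d/q) G(1, q). Reciprocity enters
  through the known values of G(1, .) at q, d and q d: as d is 3 modulo 4, exactly one of q and q d
  is 1 modulo 4, and comparing the factors \<i> leaves the sign (-1/q).\<close>

lemma gauss_sum_prime_kronecker_prime:
  assumes d: "[d = 3] (mod 4)" and q: "prime q" "coprime q d"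
  shows "gauss_sum (int q) d = of_int (kronecker_prime (- int d) (int q)) * gauss_sum 1 d"
proof (cases "q = 2")
  case True
  have "odd d"
    using d unfolding cong_def by presburger
  \<comment> \<open>The number - d is 1 modulo 4, so the case -1 modulo 8 in
    \<open>kronecker_prime\<close> cannot occur.\<close>
  have neg: "((- e) mod 8 = 1 \<longleftrightarrow> e mod 8 = 7) \<and> (- e) mod 8 \<noteq> 7" if "e mod 4 = 3" for e :: int
    using that by presburger
  have "int d mod 4 = int (d mod 4)" and d8: "int d mod 8 = int (d mod 8)"
    by (simp_all only: zmod_int of_nat_numeral)
  moreover have "d mod 4 = 3"
    using d by (simp add: cong_def)
  ultimately have "int d mod 4 = 3"
    by linarith
  moreover have "int d mod 8 = 7 \<longleftrightarrow> d mod 8 = 7"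
    using d8 by linarith
  ultimately have "(- int d) mod 8 = 1 \<longleftrightarrow> d mod 8 = 7" "(- int d) mod 8 \<noteq> 7"
    using neg[of "int d"] by blast+
  with \<open>odd d\<close> have "kronecker_prime (- int d) 2 = (if [d = 7] (mod 8) then 1 else - 1)"
    by (simp add: kronecker_prime_def cong_def)
  then show ?thesis
    using gauss_sum_two[OF d] True by simp
next
  case False
  then have "2 < q"
    using prime_ge_2_nat[OF q(1)] by linarith
  with q(1) have q2: "2 < q" "odd q"
    using prime_odd_nat by blast+
  have "odd d"
    using d unfolding cong_def by presburger
  moreover have "\<not> [d = 1] (mod 4)"
    using d by (simp add: cong_def)
  ultimately have d1: "odd d" "\<not> [d = 1] (mod 4)"
    by blast+
  have d0: "d > 0"
    using d1 by (cases d) auto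
  have dq: "coprime (int d) (int q)"
    using q(2) by (simp add: coprime_commute)
  define L where "L = Legendre (int d) (int q)"
  have L: "L = 1 \<or> L = - 1"
    using dq q2 unfolding L_def Legendre_def by (auto simp: cong_0_iff dest: coprime_common_divisor)
  have "gauss_sum 1 (q * d) = gauss_sum (int q) d * gauss_sum (int d) q"
    using gauss_sum_mult_modulus[of q d 1] q2 d0 q(2) by simp
  also have "gauss_sum (int d) q = of_int L * gauss_sum 1 q"
    unfolding L_def by (rule gauss_sum_prime) fact+
  finally have rec: "gauss_sum 1 (q * d) = gauss_sum (int q) d * (of_int L * gauss_sum 1 q)" .
  have qd: "[q * d = 1] (mod 4) \<longleftrightarrow> \<not> [q = 1] (mod 4)"
  proof -
    have "q mod 4 = 1 \<or> q mod 4 = 3"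
      using q2 by presburger
    moreover have "q * d mod 4 = (q mod 4) * 3 mod 4"
      using d mod_mult_eq[of q 4 d] by (simp only: cong_def) simp
    ultimately show ?thesis
      unfolding cong_def by (elim disjE) (simp_all only:, simp_all)
  qed
  have K: "kronecker_prime (- int d) (int q) = Legendre (- 1) q * L"
    using Legendre_mult[OF q(1) q2(1), of "- 1" "int d"] False by (simp add: kronecker_prime_def L_def)
  define X where "X = gauss_sum (int q) d"
  have eq: "gauss_sum 1 (q * d) = X * of_int L * gauss_sum 1 q"
    using rec by (simp add: X_def)
  have nz: "complex_of_real (sqrt (real q)) \<noteq> 0"
    using q2 by simp
  have "X = of_int (Legendre (- 1) q * L) * gauss_sum 1 d"
  proof (cases "[q = 1] (mod 4)")
    case True
    then have "\<i> * of_real (sqrt (real d)) * of_real (sqrt (real q)) = X * of_int L * of_real (sqrt (real q))"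
      using eq qd q2 d1 by (simp add: gauss_sum_one real_sqrt_mult mult_ac)
    then have "\<i> * of_real (sqrt (real d)) = X * of_int L"
      by (rule mult_right_cancel[OF nz, THEN iffD1])
    then show ?thesis
      using L True d1 by (auto simp: gauss_sum_one Legendre_minus_one[OF q(1) q2(1)])
  next
    case False
    then have "of_real (sqrt (real d)) * of_real (sqrt (real q)) = X * of_int L * \<i> * of_real (sqrt (real q))"
      using eq qd q2 d1 by (simp add: gauss_sum_one real_sqrt_mult mult_ac)
    then have "of_real (sqrt (real d)) = X * of_int L * \<i>"
      by (rule mult_right_cancel[OF nz, THEN iffD1])
    then have "\<i> * of_real (sqrt (real d)) = - (X * of_int L)"
      by (simp add: mult_ac)
    then show ?thesis
      using L False d1 by (auto simp: gauss_sum_one Legendre_minus_one[OF q(1) q2(1)] minus_equation_iff)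
  qed
  then show ?thesis
    unfolding K X_def .
qed

text \<open>Prime factors of k are split off one at a time; the additional factor G(1, d) from
  \<open>gauss_sum_mult\<close> is nonzero and cancels.\<close>

lemma gauss_sum_kronecker:
  assumes d: "[d = 3] (mod 4)" and "k > 0" "coprime k d"
  shows "gauss_sum (int k) d = of_int (kronecker (- int d) (int k)) * gauss_sum 1 d"
  using assms(2,3)
proof (induction k rule: less_induct)
  case (less k)
  have odd: "odd d"
    using d unfolding cong_def by presburger
  show ?case
  proof (cases "k = 1")
    case False
    then obtain q where q: "prime q" "q dvd k"
      using prime_factor_nat by blast
    from q(2) obtain m where k: "k = q * m"
      by (elim dvdE)
    have m: "m > 0" "m < k"
      using less.prems(1) k prime_gt_1_nat[OF q(1)] by auto
    have cop: "coprime q d" "coprime m d"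
      using less.prems(2) k by auto
    have "gauss_sum (int k) d * gauss_sum 1 d = gauss_sum (int q) d * gauss_sum (int m) d"
      using gauss_sum_mult[of d "int q" "int m"] odd cop k by simp
    also have "\<dots> = of_int (kronecker_prime (- int d) (int q) * kronecker (- int d) (int m)) * gauss_sum 1 d * gauss_sum 1 d"
      using less.IH[OF m(2,1) cop(2)] gauss_sum_prime_kronecker_prime[OF d q(1) cop(1)] by simp
    also have "kronecker_prime (- int d) (int q) * kronecker (- int d) (int m) = kronecker (- int d) (int k)"
      using kronecker_prime_mult[of "int q" "int m"] q(1) m k by simp
    finally show ?thesis
      using gauss_sum_nonzero[of d 1] odd by simp
  qed simp
qed

lemma Im_gauss_sum_kronecker:
  assumes d: "[d = 3] (mod 4)" and "k > 0"
  shows "(if coprime k d then Im (gauss_sum (int k) d) else 0) =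
    of_int (kronecker (- int d) (int k)) * sqrt (real d)"
proof -
  have d1: "odd d"
    using d unfolding cong_def by presburger
  have d2: "\<not> [d = 1] (mod 4)"
    using d by (simp add: cong_def)
  show ?thesis
  proof (cases "coprime k d")
    case True
    then show ?thesis
      using gauss_sum_kronecker[OF d \<open>k > 0\<close> True] d1 d2 by (simp add: gauss_sum_one)
  next
    case False
    then show ?thesis
      using kronecker_eq_0[of "int k" "- int d"] d1 \<open>k > 0\<close> by simp
  qed
qed

subsection \<open>The sine series of the sawtooth function\<close>

text \<open>The Dirichlet kernel, multiplied out so that it also covers sin (t / 2) = 0. Each
  product on the left is a difference of two sines, and these telescope.\<close>

lemma sum_cos_multiples:
  fixes t :: real
  shows "2 * sin (t / 2) * (\<Sum>k<n. cos (real (Suc k) * t)) = sin ((real n + 1 / 2) * t) - sin (t / 2)"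
proof (induction n)
  case (Suc n)
  have "2 * sin (t / 2) * cos (real (Suc n) * t) =
      sin (real (Suc n) * t + t / 2) - sin (real (Suc n) * t - t / 2)"
    by (simp add: sin_add sin_diff)
  also have "real (Suc n) * t + t / 2 = (real (Suc n) + 1 / 2) * t"
    by (simp add: algebra_simps)
  also have "real (Suc n) * t - t / 2 = (real n + 1 / 2) * t"
    by (simp add: field_simps)
  finally show ?case
    using Suc by (simp add: ring_distribs)
qed simp

definition sine_sum :: "nat \<Rightarrow> real \<Rightarrow> real" where
  "sine_sum n t = (\<Sum>k<n. sin (real (Suc k) * t) / real (Suc k))"

text \<open>
  The cosine term compensates the oscillation of the Dirichlet kernel to first order, so that
  the derivative of the error is \<open>O(1/n)\<close> away from the multiples of \<open>2\<pi>\<close>.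
\<close>

definition sine_sum_error :: "nat \<Rightarrow> real \<Rightarrow> real" where
  "sine_sum_error n t =
     sine_sum n t - (pi - t) / 2 + cos ((real n + 1 / 2) * t) / (real (2 * n + 1) * sin (t / 2))"

text \<open>Differentiating the numerator of the compensating term cancels the Dirichlet kernel.
  Only the derivative of 1 / sin (t / 2) remains, with its factor 1 / (2 n + 1).\<close>

lemma sine_sum_error_deriv:
  assumes "sin (t / 2) \<noteq> 0"
  shows "(sine_sum_error n has_field_derivative
    - (cos ((real n + 1 / 2) * t) * cos (t / 2) / (2 * real (2 * n + 1) * (sin (t / 2))\<^sup>2))) (at t within X)"
proof -
  define s c where "s = sin (t / 2)" and "c = cos (t / 2)"
  define u v where "u = sin ((real n + 1 / 2) * t)" and "v = cos ((real n + 1 / 2) * t)"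
  define M where "M = real (2 * n + 1)"
  have M: "M > 0" "real n + 1 / 2 = M / 2" by (simp_all add: M_def)
  have s: "s \<noteq> 0" using assms by (simp add: s_def)
  have "((\<lambda>t. sine_sum n t) has_field_derivative (\<Sum>k<n. cos (real (Suc k) * t))) (at t within X)"
    unfolding sine_sum_def by (intro DERIV_sum) (auto intro!: derivative_eq_intros)
  moreover have "(\<Sum>k<n. cos (real (Suc k) * t)) = u / (2 * s) - 1 / 2"
    using sum_cos_multiples[of t n] s by (simp add: s_def u_def field_simps)
  ultimately have S: "((\<lambda>t. sine_sum n t) has_field_derivative u / (2 * s) - 1 / 2) (at t within X)"
    by simp
  have V: "((\<lambda>t. cos ((real n + 1 / 2) * t)) has_field_derivative - u * (M / 2)) (at t within X)"
    unfolding M(2)[symmetric] u_def by (auto intro!: derivative_eq_intros)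
  have W: "((\<lambda>t. M * sin (t / 2)) has_field_derivative M * (c / 2)) (at t within X)"
    unfolding c_def by (auto intro!: derivative_eq_intros)
  have Q: "((\<lambda>t. cos ((real n + 1 / 2) * t) / (M * sin (t / 2))) has_field_derivative
      (- u * (M / 2) * (M * s) - v * (M * (c / 2))) / (M * s * (M * s))) (at t within X)"
    using DERIV_divide[OF V W] s M(1) by (simp add: s_def v_def)
  have "(sine_sum_error n has_field_derivative
      (u / (2 * s) - 1 / 2) - (- 1 / 2) + (- u * (M / 2) * (M * s) - v * (M * (c / 2))) / (M * s * (M * s))) (at t within X)"
    unfolding sine_sum_error_def[abs_def] M_def[symmetric]
    by (intro DERIV_add DERIV_diff S Q) (auto intro!: derivative_eq_intros)
  also have "(u / (2 * s) - 1 / 2) - (- 1 / 2) + (- u * (M / 2) * (M * s) - v * (M * (c / 2))) / (M * s * (M * s)) =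
      - (v * c / (2 * M * s\<^sup>2))"
    using s M(1) by (simp add: field_simps power2_eq_square)
  finally show ?thesis
    by (simp only: s_def c_def u_def v_def M_def)
qed

lemma sin_half_ge_on_segment:
  assumes "0 < x" "x < 2 * pi" "t \<in> closed_segment pi x"
  shows "sin (t / 2) \<ge> sin (x / 2)"
proof (cases "x \<le> pi")
  case True
  then show ?thesis
    using assms by (intro sin_monotone_2pi_le) (auto simp: closed_segment_eq_real_ivl split: if_splits)
next
  case False
  then have "sin (pi - x / 2) \<le> sin (pi - t / 2)"
    using assms by (intro sin_monotone_2pi_le) (auto simp: closed_segment_eq_real_ivl split: if_splits)
  then show ?thesis by simp
qed

text \<open>The error vanishes at \<pi>, so the mean value inequality on the segment from \<pi> to x
  bounds it; sin (t / 2) is smallest there at x. The summand 1 / s pays for the compensating cosine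
  term.\<close>

lemma sine_sum_bound:
  assumes x: "0 < x" "x < 2 * pi"
  defines "s \<equiv> sin (x / 2)"
  shows "\<bar>sine_sum n x - (pi - x) / 2\<bar> \<le> (\<bar>x - pi\<bar> / (2 * s\<^sup>2) + 1 / s) / real (2 * n + 1)"
proof -
  have s: "s > 0"
    unfolding s_def using x by (intro sin_gt_zero) auto
  define M where "M = real (2 * n + 1)"
  have M: "M > 0" by (simp add: M_def)
  have "norm (sine_sum_error n x - sine_sum_error n pi) \<le> 1 / (2 * M * s\<^sup>2) * norm (x - pi)"
  proof (rule field_differentiable_bound)
    fix t assume t: "t \<in> closed_segment pi x"
    have st: "sin (t / 2) \<ge> s"
      unfolding s_def by (rule sin_half_ge_on_segment) fact+
    with s show "(sine_sum_error n has_field_derivative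
        - (cos ((real n + 1 / 2) * t) * cos (t / 2) / (2 * real (2 * n + 1) * (sin (t / 2))\<^sup>2))) (at t within closed_segment pi x)"
      by (intro sine_sum_error_deriv) simp
    have "\<bar>cos ((real n + 1 / 2) * t) * cos (t / 2)\<bar> \<le> 1 * 1"
      unfolding abs_mult by (intro mult_mono) auto
    moreover have "2 * M * s\<^sup>2 \<le> 2 * M * (sin (t / 2))\<^sup>2"
      using st s M by (intro mult_left_mono power_mono) auto
    moreover have "2 * M * s\<^sup>2 > 0"
      using s M by simp
    ultimately have "\<bar>cos ((real n + 1 / 2) * t) * cos (t / 2)\<bar> / (2 * M * (sin (t / 2))\<^sup>2) \<le> 1 / (2 * M * s\<^sup>2)"
      by (intro frac_le) auto
    then show "norm (- (cos ((real n + 1 / 2) * t) * cos (t / 2) / (2 * real (2 * n + 1) * (sin (t / 2))\<^sup>2))) \<le> 1 / (2 * M * s\<^sup>2)"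
      unfolding M_def[symmetric] using M by (simp add: abs_mult)
  qed auto
  moreover have "sine_sum_error n pi = 0"
  proof -
    have "cos ((real n + 1 / 2) * pi) = 0"
      by (simp add: distrib_right cos_add)
    moreover have "sin (real (Suc k) * pi) = 0" for k
      using sin_npi by blast
    ultimately show ?thesis
      by (simp add: sine_sum_error_def sine_sum_def del: of_nat_Suc)
  qed
  ultimately have E: "\<bar>sine_sum_error n x\<bar> \<le> \<bar>x - pi\<bar> / (2 * s\<^sup>2) / M"
    by (simp add: field_simps)
  have C: "\<bar>cos ((real n + 1 / 2) * x) / (M * s)\<bar> \<le> 1 / s / M"
    using M s by (simp add: abs_mult divide_simps)
  have "sine_sum n x - (pi - x) / 2 = sine_sum_error n x - cos ((real n + 1 / 2) * x) / (M * s)"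
    by (simp add: sine_sum_error_def M_def s_def)
  then have "\<bar>sine_sum n x - (pi - x) / 2\<bar> \<le> \<bar>x - pi\<bar> / (2 * s\<^sup>2) / M + 1 / s / M"
    using E C by linarith
  then show ?thesis
    by (simp add: M_def add_divide_distrib)
qed

lemma sawtooth_sine_series:
  assumes "0 < x" "x < 2 * pi"
  shows "(\<lambda>k. sin (real (Suc k) * x) / real (Suc k)) sums ((pi - x) / 2)"
proof -
  define K where "K = \<bar>x - pi\<bar> / (2 * (sin (x / 2))\<^sup>2) + 1 / sin (x / 2)"
  have "(\<lambda>n. sine_sum n x - (pi - x) / 2) \<longlonglongrightarrow> 0"
  proof (rule Lim_null_comparison)
    show "\<forall>\<^sub>F n in sequentially. norm (sine_sum n x - (pi - x) / 2) \<le> K / real (2 * n + 1)"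
      using sine_sum_bound[OF assms] by (simp add: K_def)
    show "(\<lambda>n. K / real (2 * n + 1)) \<longlonglongrightarrow> 0"
      by real_asymp
  qed
  then show ?thesis
    by (simp add: LIM_zero_iff sums_def sine_sum_def)
qed

subsection \<open>The sawtooth sum and values of L-functions\<close>

text \<open>At multiples of \<open>n\<close> all terms are 0, which is the reason for the value 0 of
  the sawtooth there. Elsewhere x = 2 \<pi> r / n turns (\<pi> - x) / 2 into \<pi> (1/2 -
  r/n).\<close>

lemma unity_root_sine_series:
  assumes n: "n > 0"
  shows "(\<lambda>k. Im (unity_root n (int (Suc k) * m)) / real (Suc k)) sums
    (if int n dvd m then 0 else pi * (1 / 2 - real_of_int (m mod int n) / real n))"
proof (cases "int n dvd m")
  case True
  have "unity_root n (int (Suc k) * m) = 1" for k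
    using True n by (subst unity_root_eq_1_iff) auto
  then show ?thesis
    using True by simp
next
  case False
  define r where "r = m mod int n"
  have "r \<noteq> 0" "0 \<le> r" "r < int n"
    using False n by (auto simp: r_def dvd_eq_mod_eq_0)
  then have r: "0 < r" "r < int n"
    by auto
  define x where "x = 2 * pi * real_of_int r / real n"
  have "real_of_int r < real n"
    using r by linarith
  then have x: "0 < x" "x < 2 * pi"
    using r n by (simp_all add: x_def field_simps)
  have "unity_root n (int (Suc k) * m) = unity_root n (int (Suc k) * r)" for k
    by (intro unity_root_cong cong_scalar_left) (simp add: r_def cong_def)
  then have Im: "Im (unity_root n (int (Suc k) * m)) = sin (real (Suc k) * x)" for k
    by (simp add: unity_root_def x_def mult_ac)
  have half: "pi * (1 / 2 - real_of_int (m mod int n) / real n) = (pi - x) / 2"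
    by (simp add: x_def r_def field_simps)
  show ?thesis
    using sawtooth_sine_series[OF x] False by (simp only: Im half if_False)
qed

definition sawtooth_sum :: "nat \<Rightarrow> real" where
  "sawtooth_sum n = (\<Sum>x\<in>{0..<int n}.
     if int n dvd x\<^sup>2 then 0 else 1 / 2 - real_of_int (x\<^sup>2 mod int n) / real n)"

lemma gauss_sum_series:
  assumes "n > 0"
  shows "(\<lambda>k. Im (gauss_sum (int (Suc k)) n) / real (Suc k)) sums (pi * sawtooth_sum n)"
proof -
  have "(\<lambda>k. \<Sum>x\<in>{0..<int n}. Im (unity_root n (int (Suc k) * x\<^sup>2)) / real (Suc k)) sums
      (\<Sum>x\<in>{0..<int n}. if int n dvd x\<^sup>2 then 0 else pi * (1 / 2 - real_of_int (x\<^sup>2 mod int n) / real n))"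
    by (intro sums_sum unity_root_sine_series assms)
  also have "(\<Sum>x\<in>{0..<int n}. if int n dvd x\<^sup>2 then 0 else pi * (1 / 2 - real_of_int (x\<^sup>2 mod int n) / real n)) =
      pi * sawtooth_sum n"
    unfolding sawtooth_sum_def sum_distrib_left by (intro sum.cong refl) auto
  finally show ?thesis
    unfolding gauss_sum_def Im_sum sum_divide_distrib .
qed

section \<open>Splitting the Gauss sum series over the divisors of n\<close>

definition coprime_term :: "nat \<Rightarrow> nat \<Rightarrow> real" where
  "coprime_term d j = (if coprime j d then Im (gauss_sum (int j) d) / real j else 0)"

text \<open>If n / d divides k with a quotient coprime to d, then n / d = gcd(k, n), so exactly one
  divisor contributes. For it the factor g gained by the Gauss sum cancels against k = g k0.\<close>

lemma Im_gauss_sum_decompose: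
  assumes "n > 0" "k > 0"
  shows "Im (gauss_sum (int k) n) / real k =
    (\<Sum>d | d dvd n. if n div d dvd k then coprime_term d (k div (n div d)) else 0)"
proof -
  define g where "g = gcd k n"
  define d0 where "d0 = n div g"
  define k0 where "k0 = k div g"
  have g: "g > 0" using assms by (simp add: g_def)
  have eq: "n = d0 * g" "k = g * k0"
    by (simp_all add: d0_def k0_def g_def)
  have pos: "d0 > 0" "k0 > 0"
    using assms eq by (metis gr0I mult_zero_left, metis gr0I mult_zero_right)
  have cop: "coprime k0 d0"
    unfolding k0_def d0_def g_def using assms div_gcd_coprime by auto
  have nd: "n div d0 = g"
    using eq pos by simp
  have "(if n div d dvd k then coprime_term d (k div (n div d)) else 0) =
      (if d = d0 then coprime_term d0 k0 else 0)" if d: "d dvd n" for d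
  proof (cases "d = d0")
    case True
    then show ?thesis
      using nd eq g by (simp add: k0_def[symmetric])
  next
    case False
    from d obtain h where h: "n = d * h"
      by (elim dvdE)
    have hpos: "h > 0" "d > 0"
      using h assms(1) by auto
    have nh: "n div d = h"
      using h hpos by simp
    have "coprime_term d (k div h) = 0" if hk: "h dvd k"
    proof -
      from hk obtain j where j: "k = h * j"
        by (elim dvdE)
      have "\<not> coprime j d"
      proof
        assume "coprime j d"
        then have "gcd k n = h"
          unfolding h j by (simp add: mult.commute[of d] gcd_mult_distrib_nat[symmetric])
        then have "d = d0"
          unfolding d0_def g_def using nh h hpos by auto
        with False show False by simp
      qed
      then show ?thesis
        using j hpos by (simp add: coprime_term_def)
    qed
    then show ?thesis
      using False nh by auto
  qed
  then have "(\<Sum>d | d dvd n. if n div d dvd k then coprime_term d (k div (n div d)) else 0) =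
      (\<Sum>d | d dvd n. if d = d0 then coprime_term d0 k0 else 0)"
    by (intro sum.cong) auto
  also have "\<dots> = coprime_term d0 k0"
    using assms(1) eq(1) by (subst sum.delta) auto
  also have "\<dots> = Im (gauss_sum (int k0) d0) / real k0"
    using cop by (simp add: coprime_term_def)
  also have "\<dots> = Im (gauss_sum (int k) n) / real k"
    using gauss_sum_scale[of d0 g "int k0"] eq pos g by simp
  finally show ?thesis ..
qed

lemma sums_dilate:
  fixes A :: "nat \<Rightarrow> real"
  assumes g: "g > 0" and "(\<lambda>j. A (Suc j)) sums s"
  shows "(\<lambda>k. if g dvd Suc k then A (Suc k div g) else 0) sums s"
proof -
  \<comment> \<open>The position, counted from 0, of the series term whose index is the multiple g
    (j + 1).\<close>
  define h where "h j = g * Suc j - 1" for j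
  have h: "Suc (h j) = g * Suc j" for j
    using g by (simp add: h_def)
  have "strict_mono h"
  proof (rule strict_monoI)
    fix i j :: nat assume "i < j"
    then have "Suc (h i) < Suc (h j)"
      unfolding h using g by simp
    then show "h i < h j" by simp
  qed
  moreover have "(if g dvd Suc k then A (Suc k div g) else 0) = 0" if "k \<notin> range h" for k
  proof -
    have "\<not> g dvd Suc k"
    proof
      assume "g dvd Suc k"
      then obtain i where i: "Suc k = g * i"
        by (elim dvdE)
      then have "i \<noteq> 0"
        by (metis mult_0_right nat.distinct(1))
      then obtain j where "i = Suc j"
        using not0_implies_Suc by blast
      then have "k = h j"
        using i h[of j] by simp
      with that show False by simp
    qed
    then show ?thesis by simp
  qed
  ultimately have "(\<lambda>j. if g dvd Suc (h j) then A (Suc (h j) div g) else 0) sums s \<longleftrightarrow>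
      (\<lambda>k. if g dvd Suc k then A (Suc k div g) else 0) sums s"
    by (rule sums_mono_reindex)
  moreover have "(\<lambda>j. if g dvd Suc (h j) then A (Suc (h j) div g) else 0) = (\<lambda>j. A (Suc j))"
    using g by (simp add: h del: mult_Suc_right)
  ultimately show ?thesis
    using assms(2) by simp
qed

text \<open>
  The series over \<open>k\<close> coprime to \<open>n\<close> is what remains of the full series after removing the
  dilated series of the proper divisors, so it converges by induction on \<open>n\<close>.
\<close>

lemma summable_coprime_term:
  "n > 0 \<Longrightarrow> summable (\<lambda>j. coprime_term n (Suc j))"
proof (induction n rule: less_induct)
  case (less n)
  define B where "B d k = (if n div d dvd k then coprime_term d (k div (n div d)) else 0)" for d k
  have "summable (\<lambda>k. B d (Suc k))" if "d dvd n" "d \<noteq> n" for d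
  proof -
    have "d < n" "d > 0" "n div d > 0"
      using that less.prems by (auto intro: dvd_imp_le le_neq_implies_less dvd_pos_nat simp: div_greater_zero_iff dvd_imp_le)
    then have "(\<lambda>j. coprime_term d (Suc j)) sums (\<Sum>j. coprime_term d (Suc j))"
      using less.IH by (intro summable_sums) auto
    then have "(\<lambda>k. B d (Suc k)) sums (\<Sum>j. coprime_term d (Suc j))"
      unfolding B_def by (rule sums_dilate[OF \<open>n div d > 0\<close>])
    then show ?thesis
      by (rule sums_summable)
  qed
  then have "summable (\<lambda>k. \<Sum>d\<in>{d. d dvd n} - {n}. B d (Suc k))"
    by (intro summable_sum) auto
  moreover have "summable (\<lambda>k. Im (gauss_sum (int (Suc k)) n) / real (Suc k))"
    using gauss_sum_series[OF less.prems] by (rule sums_summable)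
  ultimately have "summable (\<lambda>k. Im (gauss_sum (int (Suc k)) n) / real (Suc k) -
      (\<Sum>d\<in>{d. d dvd n} - {n}. B d (Suc k)))"
    by (rule summable_diff[rotated])
  moreover have "Im (gauss_sum (int (Suc k)) n) / real (Suc k) -
      (\<Sum>d\<in>{d. d dvd n} - {n}. B d (Suc k)) = coprime_term n (Suc k)" for k
  proof -
    have "Im (gauss_sum (int (Suc k)) n) / real (Suc k) = (\<Sum>d | d dvd n. B d (Suc k))"
      unfolding B_def using less.prems by (intro Im_gauss_sum_decompose) auto
    also have "\<dots> = B n (Suc k) + (\<Sum>d\<in>{d. d dvd n} - {n}. B d (Suc k))"
      using less.prems by (intro sum.remove) auto
    also have "B n (Suc k) = coprime_term n (Suc k)"
      using less.prems by (simp add: B_def)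
    finally show ?thesis by simp
  qed
  ultimately show ?case by simp
qed

lemma sawtooth_sum_eq_suminf:
  assumes "n > 0"
  shows "pi * sawtooth_sum n = (\<Sum>d | d dvd n. \<Sum>j. coprime_term d (Suc j))"
proof -
  have "(\<lambda>k. \<Sum>d | d dvd n. if n div d dvd Suc k then coprime_term d (Suc k div (n div d)) else 0) sums
      (\<Sum>d | d dvd n. \<Sum>j. coprime_term d (Suc j))"
  proof (rule sums_sum)
    fix d assume "d \<in> {d. d dvd n}"
    then have "d > 0" "n div d > 0"
      using assms by (auto intro: dvd_pos_nat simp: div_greater_zero_iff dvd_imp_le)
    then show "(\<lambda>k. if n div d dvd Suc k then coprime_term d (Suc k div (n div d)) else 0) sums
        (\<Sum>j. coprime_term d (Suc j))"
      by (intro sums_dilate summable_sums summable_coprime_term)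
  qed
  moreover have "(\<lambda>k. Im (gauss_sum (int (Suc k)) n) / real (Suc k)) =
      (\<lambda>k. \<Sum>d | d dvd n. if n div d dvd Suc k then coprime_term d (Suc k div (n div d)) else 0)"
    using assms by (intro ext Im_gauss_sum_decompose) auto
  ultimately show ?thesis
    using gauss_sum_series[OF assms] by (simp only: sums_unique2)
qed

lemma suminf_coprime_term_cong_1:
  assumes "[d = 1] (mod 4)"
  shows "(\<Sum>j. coprime_term d (Suc j)) = 0"
proof -
  have "coprime_term d j = 0" for j
    using Im_gauss_sum_cong_1_mod_4[OF assms, of "int j"] by (simp add: coprime_term_def)
  then show ?thesis by simp
qed

lemma suminf_coprime_term_cong_3:
  assumes "[d = 3] (mod 4)"
  shows "(\<Sum>j. coprime_term d (Suc j)) = sqrt (real d) * Dirichlet_L 1 (kronecker (- int d))"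
proof -
  define f where "f j = real_of_int (kronecker (- int d) (int (Suc j))) / real (Suc j) powr 1" for j
  have d: "d > 0"
    using assms by (cases d) (auto simp: cong_def)
  have eq: "coprime_term d (Suc j) = sqrt (real d) * f j" for j
    using Im_gauss_sum_kronecker[OF assms, of "Suc j"]
    by (auto simp: coprime_term_def f_def split: if_splits)
  \<comment> \<open>\<open>Dirichlet_L\<close> is a \<open>suminf\<close>, so convergence has to be
    transferred to \<open>f\<close> before the constant can be taken out.\<close>
  have "summable (\<lambda>j. sqrt (real d) * f j)"
    using summable_coprime_term[OF d] by (simp only: eq)
  then have "summable f"
    using d by (simp add: summable_cmult_iff)
  then have "(\<Sum>j. sqrt (real d) * f j) = sqrt (real d) * suminf f"
    by (rule suminf_mult)
  moreover have "Dirichlet_L 1 (kronecker (- int d)) = suminf f"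
    unfolding Dirichlet_L_def f_def ..
  ultimately show ?thesis
    by (simp only: eq)
qed

lemma sawtooth_sum_eq_L:
  assumes "odd n"
  shows "pi * sawtooth_sum n =
    (\<Sum>d | d dvd n \<and> [d = 3] (mod 4). sqrt (real d) * Dirichlet_L 1 (kronecker (- int d)))"
proof -
  have n: "n > 0"
    using assms by (cases n) auto
  have "pi * sawtooth_sum n = (\<Sum>d | d dvd n. \<Sum>j. coprime_term d (Suc j))"
    using n by (rule sawtooth_sum_eq_suminf)
  also have "\<dots> = (\<Sum>d | d dvd n \<and> [d = 3] (mod 4). \<Sum>j. coprime_term d (Suc j))"
  proof (rule sum.mono_neutral_right)
    show "\<forall>d\<in>{d. d dvd n} - {d. d dvd n \<and> [d = 3] (mod 4)}. (\<Sum>j. coprime_term d (Suc j)) = 0"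
    proof
      fix d assume d: "d \<in> {d. d dvd n} - {d. d dvd n \<and> [d = 3] (mod 4)}"
      then have "odd d"
        using assms dvd_trans by blast
      then have "d mod 4 = 1 \<or> d mod 4 = 3"
        by presburger
      with d have "[d = 1] (mod 4)"
        by (auto simp: cong_def)
      then show "(\<Sum>j. coprime_term d (Suc j)) = 0"
        by (rule suminf_coprime_term_cong_1)
    qed
  qed (use n in auto)
  also have "\<dots> = (\<Sum>d | d dvd n \<and> [d = 3] (mod 4). sqrt (real d) * Dirichlet_L 1 (kronecker (- int d)))"
    by (intro sum.cong refl suminf_coprime_term_cong_3) auto
  finally show ?thesis .
qed

subsection \<open>Lattice points\<close>

lemma squarefree_dvd_square_iff:
  fixes a m :: nat
  assumes "squarefree a"
  shows "a dvd m\<^sup>2 \<longleftrightarrow> a dvd m"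
proof
  assume dvd: "a dvd m\<^sup>2"
  have "a > 0"
    using assms by (cases a) auto
  \<comment> \<open>Write a = a' g and m = m' g with a' coprime to m'. Then a' divides g, so its
    square divides the squarefree \<open>a\<close> and a' = 1.\<close>
  define g where "g = gcd a m"
  have "gcd a m \<noteq> 0"
    using \<open>a > 0\<close> by simp
  from gcd_coprime_exists[OF this] obtain a' m'
    where am: "a = a' * g" "m = m' * g" "coprime a' m'"
    unfolding g_def by blast
  have "g > 0"
    using \<open>a > 0\<close> by (simp add: g_def)
  have "a' dvd g * m'\<^sup>2"
    using dvd am \<open>g > 0\<close> by (simp add: power2_eq_square mult_ac)
  then have "a' dvd g"
    using am(3) by (simp add: coprime_dvd_mult_left_iff)
  then have "a'\<^sup>2 dvd a"
    by (simp add: am(1) power2_eq_square)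
  then have "a' = 1"
    using assms squarefreeD by force
  then show "a dvd m"
    using am by simp
qed (simp add: power2_eq_square)

text \<open>With n = a b^2 and a squarefree, b must divide m; then a divides (m / b)^2, hence m / b
  itself.\<close>

lemma dvd_square_iff_squarefree_part:
  fixes n m :: nat
  assumes "n > 0"
  shows "n dvd m\<^sup>2 \<longleftrightarrow> squarefree_part n * square_part n dvd m"
proof
  define a b where "a = squarefree_part n" and "b = square_part n"
  have n: "n = a * b\<^sup>2"
    unfolding a_def b_def by (rule squarefree_decompose)
  have b: "b > 0"
    using assms n by (cases b) auto
  {
    assume "n dvd m\<^sup>2"
    then have "b\<^sup>2 dvd m\<^sup>2"
      unfolding n by (rule dvd_mult_right)
    then have "b dvd m"
      by simp
    then obtain k where k: "m = b * k"
      by (elim dvdE)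
    have "a dvd k\<^sup>2"
      using \<open>n dvd m\<^sup>2\<close> b by (simp add: n k power_mult_distrib mult.commute)
    then have "a dvd k"
      using squarefree_dvd_square_iff[of a k] by (simp add: a_def)
    then show "a * b dvd m"
      by (simp add: k mult.commute)
  }
  assume "a * b dvd m"
  then have "(a * b)\<^sup>2 dvd m\<^sup>2"
    by simp
  moreover have "n dvd (a * b)\<^sup>2"
    by (simp add: n power2_eq_square)
  ultimately show "n dvd m\<^sup>2"
    by (rule dvd_trans[rotated])
qed

lemma sqrt_greatest_square_divisor:
  assumes "n > 0"
  shows "sqrt (real (greatest_square_divisor n)) = real (square_part n)"
proof -
  have "greatest_square_divisor n = (square_part n)\<^sup>2"
    unfolding greatest_square_divisor_def
  proof (rule Max_eqI)
    show "finite {m. m dvd n \<and> is_square m}"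
      using assms by (intro finite_subset[OF _ finite_divisors_nat]) auto
    show "m \<le> (square_part n)\<^sup>2" if m: "m \<in> {m. m dvd n \<and> is_square m}" for m
    proof -
      obtain c where c: "m = c\<^sup>2"
        using m by (auto elim: is_nth_powerE)
      then have "c dvd square_part n"
        using m by (simp add: dvd_square_part_iff)
      then have "c \<le> square_part n"
        using assms by (intro dvd_imp_le) (auto intro: gr0I)
      then show ?thesis
        by (simp add: c)
    qed
  qed (auto simp: is_nth_power_def)
  then show ?thesis by simp
qed

text \<open>The solutions are the multiples of a b up to n = (a b) b, of which there are b.\<close>

lemma card_dvd_square:
  assumes "n > 0"
  shows "card {m \<in> {1..n}. n dvd m\<^sup>2} = square_part n"
proof -
  define a b where "a = squarefree_part n" and "b = square_part n"
  have n: "n = a * b * b"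
    using squarefree_decompose[of n] by (simp add: a_def b_def power2_eq_square mult.assoc)
  have q: "a * b > 0"
    using assms n by (metis gr0I mult_zero_left)
  have "{m \<in> {1..n}. n dvd m\<^sup>2} = {m \<in> {1..n}. a * b dvd m}"
    using dvd_square_iff_squarefree_part[OF assms] by (simp add: a_def b_def)
  also have "\<dots> = (\<lambda>i. (a * b) * i) ` {1..b}"
  proof (intro equalityI subsetI)
    fix m assume "m \<in> {m \<in> {1..n}. a * b dvd m}"
    then obtain i where i: "m = (a * b) * i" "m \<in> {1..n}"
      by (auto elim!: dvdE)
    have "i \<noteq> 0"
      using i by (cases "i = 0") auto
    moreover have "(a * b) * i \<le> (a * b) * b"
      using i n by simp
    then have "i \<le> b"
      using q by (simp only: mult_le_cancel1)
    ultimately show "m \<in> (\<lambda>i. (a * b) * i) ` {1..b}"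
      using i by auto
  next
    fix m assume "m \<in> (\<lambda>i. (a * b) * i) ` {1..b}"
    then obtain i where "i \<in> {1..b}" and i: "m = (a * b) * i"
      by blast
    then have ib: "1 \<le> i" "i \<le> b"
      by auto
    have "m \<le> n"
      unfolding i n using ib(2) by (rule mult_le_mono2)
    moreover have "m \<ge> 1"
      using i ib q by (simp add: Suc_le_eq)
    ultimately show "m \<in> {m \<in> {1..n}. a * b dvd m}"
      using i by simp
  qed
  also have "card \<dots> = b"
    using q by (subst card_image) (auto intro!: inj_onI)
  finally show ?thesis
    by (simp add: b_def)
qed

section \<open>Counting lattice points column by column\<close>

lemma lattice_count_eq_sum:
  assumes "n > 0"
  shows "real (lattice_count (real n)) =
    (\<Sum>m\<in>{- int n..int n}. 2 * real_of_int (((int n)\<^sup>2 - m\<^sup>2) div int n) + 1)"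
proof -
  define c where "c m = ((int n)\<^sup>2 - m\<^sup>2) div int n" for m
  \<comment> \<open>The floor \<open>c m\<close> is the half height of column m, and it is negative
    exactly where the column is empty.\<close>
  have c0: "c m \<ge> 0 \<longleftrightarrow> m \<in> {- int n..int n}" for m
  proof -
    have "c m \<ge> 0 \<longleftrightarrow> m\<^sup>2 \<le> (int n)\<^sup>2"
      using assms by (simp add: c_def pos_imp_zdiv_nonneg_iff)
    also have "\<dots> \<longleftrightarrow> \<bar>m\<bar> \<le> int n"
      using abs_le_square_iff[of m "int n"] by simp
    finally show ?thesis by auto
  qed
  have region: "inverse (real n) *\<^sub>R (real_of_int m, real_of_int k) \<in> parabolic_region \<longleftrightarrow> \<bar>k\<bar> \<le> c m" for m k
  proof -
    have "inverse (real n) *\<^sub>R (real_of_int m, real_of_int k) \<in> parabolic_region \<longleftrightarrow>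
        \<bar>real_of_int k\<bar> / real n \<le> 1 - (real_of_int m / real n)\<^sup>2"
      by (simp add: parabolic_region_def divide_inverse mult.commute abs_mult)
    also have "\<dots> \<longleftrightarrow> \<bar>real_of_int k\<bar> * real n \<le> (real n)\<^sup>2 - (real_of_int m)\<^sup>2"
      using assms by (simp add: field_simps power2_eq_square)
    also have "\<dots> \<longleftrightarrow> real_of_int \<bar>k\<bar> \<le> real_of_int ((int n)\<^sup>2 - m\<^sup>2) / real_of_int (int n)"
      using assms by (simp add: pos_le_divide_eq)
    also have "\<dots> \<longleftrightarrow> \<bar>k\<bar> \<le> c m"
      unfolding c_def le_floor_iff[symmetric] floor_divide_of_int_eq ..
    finally show ?thesis .
  qed
  have "{z :: int \<times> int. inverse (real n) *\<^sub>R (real_of_int (fst z), real_of_int (snd z)) \<in> parabolic_region} =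
      (SIGMA m:{- int n..int n}. {- c m..c m})"
    unfolding region using c0 by (force simp: abs_le_iff)
  then have "lattice_count (real n) = (\<Sum>m\<in>{- int n..int n}. card {- c m..c m})"
    by (simp add: lattice_count_def card_SigmaI)
  then have "real (lattice_count (real n)) = (\<Sum>m\<in>{- int n..int n}. real (card {- c m..c m}))"
    by simp
  also have "\<dots> = (\<Sum>m\<in>{- int n..int n}. 2 * real_of_int (c m) + 1)"
  proof (intro sum.cong refl)
    fix m assume "m \<in> {- int n..int n}"
    then have "c m \<ge> 0"
      using c0 by simp
    then show "real (card {- c m..c m}) = 2 * real_of_int (c m) + 1"
      by simp
  qed
  finally show ?thesis
    by (simp add: c_def)
qed

lemma measure_parabolic_region: "measure lborel parabolic_region = 8 / 3"
proof -
  have "closed parabolic_region"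
    unfolding parabolic_region_def case_prod_unfold
    by (intro closed_Collect_le continuous_intros)
  then have meas: "parabolic_region \<in> sets (lborel \<Otimes>\<^sub>M lborel)"
    unfolding lborel_prod by simp
  have "emeasure lborel parabolic_region = emeasure (lborel \<Otimes>\<^sub>M lborel) parabolic_region"
    by (simp add: lborel_prod)
  also have "\<dots> = (\<integral>\<^sup>+ x. emeasure lborel (Pair x -` parabolic_region) \<partial>lborel)"
    by (rule lborel.emeasure_pair_measure_alt[OF meas])
  \<comment> \<open>Beyond |x| = 1 the section is an empty interval, whence the indicator.\<close>
  also have "\<dots> = (\<integral>\<^sup>+ x. ennreal (2 - 2 * x\<^sup>2) * indicator {- 1..1} x \<partial>lborel)"
  proof (rule nn_integral_cong)
    fix x :: real
    have "Pair x -` parabolic_region = {- (1 - x\<^sup>2)..1 - x\<^sup>2}"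
      by (auto simp: parabolic_region_def abs_le_iff)
    moreover have "x\<^sup>2 \<le> 1 \<longleftrightarrow> x \<in> {- 1..1}"
      using abs_square_le_1[of x] by auto
    ultimately show "emeasure lborel (Pair x -` parabolic_region) = ennreal (2 - 2 * x\<^sup>2) * indicator {- 1..1} x"
      by (auto simp: indicator_def not_le)
  qed
  also have "\<dots> = ennreal ((2 * 1 - 2 * 1 ^ 3 / 3) - (2 * (- 1) - 2 * (- 1) ^ 3 / 3))"
  proof (rule nn_integral_FTC_Icc)
    show "((\<lambda>x. 2 * x - 2 * x ^ 3 / 3) has_real_derivative 2 - 2 * x\<^sup>2) (at x)" for x :: real
      by (auto intro!: derivative_eq_intros)
    show "0 \<le> 2 - 2 * x\<^sup>2" if "x \<in> {- 1..1}" for x :: real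
      using that abs_square_le_1[of x] by auto
  qed auto
  also have "\<dots> = ennreal (8 / 3)"
    by simp
  finally show ?thesis
    by (simp add: measure_def)
qed

lemma sum_symmetric_interval:
  fixes f :: "int \<Rightarrow> real"
  assumes "\<And>m. f (- m) = f m"
  shows "(\<Sum>m\<in>{- int n..int n}. f m) = f 0 + 2 * (\<Sum>m=1..n. f (int m))"
proof (induction n)
  case (Suc n)
  have "{- int (Suc n)..int (Suc n)} = insert (int (Suc n)) (insert (- int (Suc n)) {- int n..int n})"
    by auto
  then have "(\<Sum>m\<in>{- int (Suc n)..int (Suc n)}. f m) = f (int (Suc n)) + (f (- int (Suc n)) + (\<Sum>m\<in>{- int n..int n}. f m))"
    by (simp del: of_nat_Suc)
  then show ?case
    using Suc by (simp add: assms del: of_nat_Suc)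
qed simp

lemma sum_of_squares: "(\<Sum>m=1..n. (real m)\<^sup>2) = real n * (real n + 1) * (2 * real n + 1) / 6"
  by (induction n) (simp_all add: field_simps power2_eq_square)

text \<open>With r the remainder of m^2 modulo n, rounding loses 1 - r/n = 1/2 + (1/2 - r/n): a mean
  loss and a centred sawtooth. If r = 0 nothing is lost, so both corrections are 0 there.\<close>

lemma real_div_square_diff:
  assumes "n > 0"
  shows "real_of_int (((int n)\<^sup>2 - m\<^sup>2) div int n) = real n - (real_of_int m)\<^sup>2 / real n -
    (if int n dvd m\<^sup>2 then 0 else 1 / 2) -
    (if int n dvd m\<^sup>2 then 0 else 1 / 2 - real_of_int (m\<^sup>2 mod int n) / real n)"
proof -
  define r where "r = m\<^sup>2 mod int n"
  define q where "q = m\<^sup>2 div int n"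
  have m: "m\<^sup>2 = q * int n + r"
    by (simp add: q_def r_def)
  have r: "0 \<le> r" "r < int n"
    using assms by (auto simp: r_def)
  have "real_of_int (m\<^sup>2) = real_of_int (q * int n + r)"
    using m by simp
  then have mr: "(real_of_int m)\<^sup>2 / real n = real_of_int q + real_of_int r / real n"
    using assms by (simp add: field_simps)
  show ?thesis
  proof (cases "int n dvd m\<^sup>2")
    case True
    then have "r = 0"
      by (simp add: r_def)
    then have "(int n)\<^sup>2 - m\<^sup>2 = (int n - q) * int n"
      using m by (simp add: algebra_simps power2_eq_square)
    then have "((int n)\<^sup>2 - m\<^sup>2) div int n = int n - q"
      using assms by simp
    then show ?thesis
      using True mr \<open>r = 0\<close> by simp
  next
    case False
    then have "r \<noteq> 0"
      by (simp add: r_def dvd_eq_mod_eq_0)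
    have "((int n)\<^sup>2 - m\<^sup>2) div int n = int n - q - 1"
    proof (rule int_div_pos_eq)
      show "(int n)\<^sup>2 - m\<^sup>2 = int n * (int n - q - 1) + (int n - r)"
        using m by (simp add: algebra_simps power2_eq_square)
    qed (use r \<open>r \<noteq> 0\<close> in auto)
    then show ?thesis
      using False mr by (simp add: r_def)
  qed
qed

lemma sum_upto_eq_sum_residues:
  fixes f :: "int \<Rightarrow> real"
  assumes "f (int n) = f 0"
  shows "(\<Sum>m=1..n. f (int m)) = (\<Sum>x\<in>{0..<int n}. f x)"
proof -
  have "(\<Sum>x\<in>{0..<int n}. f x) = (\<Sum>m<n. f (int m))"
    by (rule sum.reindex_bij_witness[where i = int and j = nat]) auto
  moreover have "(\<Sum>m=1..n. f (int m)) + f 0 = (\<Sum>m<n. f (int m)) + f (int n)"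
    by (induction n) (simp_all del: of_nat_Suc)
  ultimately show ?thesis
    using assms by simp
qed

lemma lattice_count_eq_sawtooth_sum:
  assumes n: "n > 0"
  shows "real (lattice_count (real n)) =
    8 / 3 * (real n)\<^sup>2 + 1 / 3 + 2 * real (square_part n) - 4 * sawtooth_sum n"
proof -
  \<comment> \<open>\<open>u\<close> is the mean rounding loss, whose sum needs only the count of m
    with n dividing m^2; \<open>v\<close> is the sawtooth part.\<close>
  define u where "u m = (if int n dvd m\<^sup>2 then 0 else 1 / 2 :: real)" for m
  define v where "v m = (if int n dvd m\<^sup>2 then 0 else 1 / 2 - real_of_int (m\<^sup>2 mod int n) / real n)" for m
  define f where "f m = 2 * real_of_int (((int n)\<^sup>2 - m\<^sup>2) div int n) + 1" for m
  have "(\<Sum>m=1..n. u (int m)) = (\<Sum>m=1..n. 1 / 2 - (if n dvd m\<^sup>2 then 1 / 2 else 0))"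
    by (intro sum.cong refl) (auto simp: u_def simp flip: of_nat_power)
  also have "\<dots> = real n / 2 - real (card {m \<in> {1..n}. n dvd m\<^sup>2}) / 2"
    by (simp add: sum_subtractf sum.If_cases Int_def)
  also have "\<dots> = (real n - real (square_part n)) / 2"
    by (simp only: card_dvd_square[OF n]) (simp add: diff_divide_distrib)
  finally have u: "(\<Sum>m=1..n. u (int m)) = (real n - real (square_part n)) / 2" .
  have "v (int n) = v 0"
    by (simp add: v_def power2_eq_square)
  then have v: "(\<Sum>m=1..n. v (int m)) = sawtooth_sum n"
    unfolding sawtooth_sum_def v_def[symmetric] by (rule sum_upto_eq_sum_residues)
  have "f m = 2 * real n + 1 - 2 / real n * (real_of_int m)\<^sup>2 - 2 * u m - 2 * v m" for m
    unfolding f_def u_def v_def real_div_square_diff[OF n] by (simp add: algebra_simps)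
  then have "(\<Sum>m=1..n. f (int m)) = real n * (2 * real n + 1) - 2 / real n * (\<Sum>m=1..n. (real m)\<^sup>2)
      - 2 * (\<Sum>m=1..n. u (int m)) - 2 * (\<Sum>m=1..n. v (int m))"
    by (simp add: sum_subtractf sum_distrib_left)
  also have "\<dots> = real n * (2 * real n + 1) - (real n + 1) * (2 * real n + 1) / 3
      - (real n - real (square_part n)) - 2 * sawtooth_sum n"
    unfolding u v sum_of_squares using n by (simp add: field_simps)
  finally have S: "(\<Sum>m=1..n. f (int m)) = \<dots>" .
  have "real (lattice_count (real n)) = (\<Sum>m\<in>{- int n..int n}. f m)"
    unfolding f_def by (rule lattice_count_eq_sum[OF n])
  also have "\<dots> = f 0 + 2 * (\<Sum>m=1..n. f (int m))"
    by (rule sum_symmetric_interval) (simp add: f_def)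
  also have "f 0 = 2 * real n + 1"
    using n by (simp add: f_def power2_eq_square)
  \<comment> \<open>The terms linear in n cancel, and the constants 1 and - 2/3 leave 1/3.\<close>
  finally show ?thesis
    unfolding S by (simp add: field_simps power2_eq_square)
qed

theorem theorem2:
  fixes N :: nat
  assumes "odd N"
  shows "real (lattice_count (real N)) =
           measure lborel parabolic_region * (real N)\<^sup>2 + 1 / 3
           + 2 * sqrt (real (greatest_square_divisor N))
           - 4 / pi * (\<Sum>d | d dvd N \<and> [d = 3] (mod 4).
               sqrt (real d) * Dirichlet_L 1 (kronecker (- int d)))"
proof -
  have N: "N > 0"
    using assms by (cases N) auto
  show ?thesis
    unfolding lattice_count_eq_sawtooth_sum[OF N] measure_parabolic_region
      sqrt_greatest_square_divisor[OF N] sawtooth_sum_eq_L[OF assms, symmetric]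
    by simp
qed

end
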